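(* Let $\{(\mathbf{L}^k,\mathbf{S}^k)\}_{k\ge 1}$ be a sequence generated from an initial pair $(\mathbf{L}^0,\mathbf{S}^0)\in\mathbb{R}^{m\times n}\times\mathbb{R}^{m\times n}$ by $$\mathbf{S}^k=\mathrm{sign}(\mathbf{D}-\mathcal{A}(\mathbf{L}^{k-1}))\odot\max(0,|\mathbf{D}-\mathcal{A}(\mathbf{L}^{k-1})|-\lambda),$$ $$\mathbf{L}^k=\mathbf{prox}_{t\mu}\left(\mathbf{L}^{k-1}-t\mathcal{A}^*(\mathcal{A}(\mathbf{L}^{k-1})+\mathbf{S}^{k}-\mathbf{D})\right),\qquad k\ge 1,$$ with stepsize $0<t<\frac{1}{\|\mathcal{A}\|^2}$, where $\mathbf{L}^k=\mathbf{X}^k(\mathbf{Y}^k)^\top$ and $(\mathbf{X}^k,\mathbf{Y}^k)\in\mathbb{R}^{m\times p}\times\mathbb{R}^{n\times p}$ is an optimal solution of $$\min_{\mathbf{X}\in\mathbb{R}^{m\times p},\,\mathbf{Y}\in\mathbb{R}^{n\times p}}\ \frac12\left\|\mathbf{X}\mathbf{Y}^\top-\mathbf{L}^{k-1}+t\mathcal{A}^*(\mathcal{A}(\mathbf{L}^{k-1})+\mathbf{S}^{k}-\mathbf{D})\right\|_F^2+t\mu\|\mathbf{X}\|_*\quad\text{subject to } \mathbf{Y}^\top\mathbf{Y}=\mathbf{I}_{p\times p}.$$ Then the following hold. 1. The objective values $\{E(\mathbf{L}^k,\mathbf{S}^k)\}_{k\ge1}$ are non-increasing in $k$. 2. The sequence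 $\{(\mathbf{L}^k,\mathbf{S}^k)\}_{k\ge 1}$ is bounded and thus has limit points. 3. Every limit point $(\mathbf{L}^\star,\mathbf{S}^\star)$ of $\{(\mathbf{L}^k,\mathbf{S}^k)\}_{k\ge 1}$ satisfies $$\mathbf{S}^\star=\mathrm{sign}(\mathbf{D}-\mathcal{A}(\mathbf{L}^\star))\odot\max(0,|\mathbf{D}-\mathcal{A}(\mathbf{L}^\star)|-\lambda),\qquad \mathbf{L}^\star=\mathbf{prox}_{t\mu}\left(\mathbf{L}^\star-t\mathcal{A}^*(\mathcal{A}(\mathbf{L}^\star)+\mathbf{S}^\star-\mathbf{D})\right).$$ 4. The sequence $\{(\mathbf{X}^k,\mathbf{Y}^k,\mathbf{S}^k)\}_{k\ge1}$ is also bounded. In addition, for any limit point $(\mathbf{X}^\star,\mathbf{Y}^\star,\mathbf{S}^\star)$ of $\{(\mathbf{X}^k,\mathbf{Y}^k,\mathbf{S}^k)\}_{k\ge1}$, the pair $(\mathbf{X}^\star(\mathbf{Y}^\star)^\top,\mathbf{S}^\star)$ is a limit point of $\{(\mathbf{L}^k,\mathbf{S}^k)\}_{k\ge1}$. 5. Every limit point $(\mathbf{X}^\star,\mathbf{Y}^\star,\mathbf{S}^\star)$ of $\{(\mathbf{X}^k,\mathbf{Y}^k,\mathbf{S}^k)\}_{k\ge1}$ is a stationary point of $E(\mathbf{X}\mathbf{Y}^\top,\mathbf{S})$, in the sense that it satisfies the first-order optimality condition $$\mathbf{0}\in\left[\mathcal{A}^*(\mathcal{A}(\mathbf{X}^\star(\mathbf{Y}^\star)^\top)+\mathbf{S}^\star-\mathbf{D})+\mu\,\partial\|\mathbf{X}^\star(\mathbf{Y}^\star)^\top\|_*\right]\mathbf{Y}^\star,$$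 $$\mathbf{0}\in(\mathbf{X}^\star)^\top\left[\mathcal{A}^*(\mathcal{A}(\mathbf{X}^\star(\mathbf{Y}^\star)^\top)+\mathbf{S}^\star-\mathbf{D})+\mu\,\partial\|\mathbf{X}^\star(\mathbf{Y}^\star)^\top\|_*\right],$$ $$\mathbf{0}\in\mathcal{A}(\mathbf{X}^\star(\mathbf{Y}^\star)^\top)+\mathbf{S}^\star-\mathbf{D}+\lambda\,\partial\|\mathbf{S}^\star\|_1.$$ In addition, if $\mathcal{A}=\mathcal{I}$ is the identity operator, one can take the stepsize $t=1$, and all the statements above still hold.
   Context: Let $m,n,p$ be positive integers with $p\le\min(m,n)$, let $\mathbf{D}\in\mathbb{R}^{m\times n}$, and let $\mathcal{A}$ be a (bounded) linear operator on $\mathbb{R}^{m\times n}$ with operator norm $\|\mathcal{A}\|=\sup\{\|\mathcal{A}(\mathbf{B})\|_F:\|\mathbf{B}\|_F=1\}$ and adjoint $\mathcal{A}^*$ with respect to the inner product $\langle\mathbf{B},\mathbf{C}\rangle=\mathrm{Tr}(\mathbf{B}^\top\mathbf{C})$; $\|\cdot\|_F$ is the Frobenius norm. If $\mathcal{A}=0$ the stepsize condition is read as $t>0$. The regularization parameters satisfy $\lambda>0$ and $\mu>0$; when $\mathcal{A}=\mathcal{I}$, $\mu=0$ is also allowed. $\|\mathbf{B}\|_1=\sum_{i,j}|\mathbf{B}_{i,j}|$ is the entrywise $\ell_1$-norm, $\|\mathbf{B}\|_*$ is the nuclear norm (sum of singular values), and $\partial\|\mathbf{B}\|_1$, $\partial\|\mathbf{B}\|_*$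 denote the (convex) subdifferentials of these norms at $\mathbf{B}$, as subsets of the matrix space. For a set $\mathcal{G}$ of matrices, $\mathcal{G}\mathbf{Y}=\{\mathbf{G}\mathbf{Y}:\mathbf{G}\in\mathcal{G}\}$, and similarly for multiplication on the left. $\odot$ is entrywise multiplication; $\mathrm{sign}$, $|\cdot|$, subtraction of $\lambda$, and $\max(0,\cdot)$ act on matrices entrywise. $\mathbf{I}_{p\times p}$ is the identity matrix. The objective function is $$E(\mathbf{L},\mathbf{S})=\frac12\|\mathcal{A}(\mathbf{L})+\mathbf{S}-\mathbf{D}\|_F^2+\lambda\|\mathbf{S}\|_1+\mu\|\mathbf{L}\|_*.$$ For $\nu\ge0$, the proximal operator is $$\mathbf{prox}_{\nu}(\mathbf{B})=\operatorname*{arg\,min}_{\mathbf{L}\in\mathbb{R}^{m\times n}:\ \mathrm{rank}(\mathbf{L})\le p}\ \frac12\|\mathbf{L}-\mathbf{B}\|_F^2+\nu\|\mathbf{L}\|_*.$$ Minimizers need not be unique; "$\mathbf{L}=\mathbf{prox}_\nu(\mathbf{B})$" means that $\mathbf{L}$ is one of the minimizers. A limit point of a sequence is the limit of a convergent subsequence. *)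

theory Defs
  imports "HOL-Analysis.Analysis"
begin

text \<open>
  The type \<open>real^'n^'m\<close> consists of matrices with \<open>CARD('m)\<close> rows and \<open>CARD('n)\<close> columns. On it
  \<^const>\<open>norm\<close> is the Frobenius norm and \<^const>\<open>inner\<close> the trace inner product, so that
  \<^const>\<open>onorm\<close> and \<^const>\<open>adjoint\<close> are the operator norm and the adjoint with respect to them.
\<close>

lemma norm_matrix_frobenius: "norm B = sqrt (\<Sum>i\<in>UNIV. \<Sum>j\<in>UNIV. (B $ i $ j)\<^sup>2)"
  for B :: "real^'n^'m"
  by (simp add: norm_vec_def L2_set_def sum_nonneg)

lemma inner_matrix_trace: "inner B C = trace (transpose B ** C)"
  for B C :: "real^'n^'m"
  unfolding inner_vec_def trace_def matrix_matrix_mult_def transpose_def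
  by (simp, rule sum.swap)

definition l1_norm :: "real^'n^'m \<Rightarrow> real" where
  "l1_norm B = (\<Sum>i\<in>UNIV. \<Sum>j\<in>UNIV. \<bar>B $ i $ j\<bar>)"

definition singular_values :: "real^'n^'m \<Rightarrow> real set" where
  "singular_values B =
     {\<sigma>. 0 \<le> \<sigma> \<and> (\<exists>v. v \<noteq> 0 \<and> (transpose B ** B) *v v = \<sigma>\<^sup>2 *\<^sub>R v)}"

text \<open>
  Since \<open>transpose B ** B\<close> is symmetric, geometric and algebraic multiplicities agree.
\<close>

definition singular_value_multiplicity :: "real^'n^'m \<Rightarrow> real \<Rightarrow> nat" where
  "singular_value_multiplicity B \<sigma> = dim {v. (transpose B ** B) *v v = \<sigma>\<^sup>2 *\<^sub>R v}"

lemma finite_singular_values: "finite (singular_values B)"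
  for B :: "real^'n^'m"
proof -
  define M where "M = transpose B ** B"
  have sym: "inner (M *v x) y = inner x (M *v y)" for x y
    unfolding M_def
    by (metis dot_lmul_matrix inner_commute matrix_vector_mul_assoc transpose_matrix_vector
        transpose_transpose)
  define v where "v \<sigma> = (SOME v. v \<noteq> 0 \<and> M *v v = \<sigma>\<^sup>2 *\<^sub>R v)" for \<sigma> :: real
  have v: "v \<sigma> \<noteq> 0" "M *v v \<sigma> = \<sigma>\<^sup>2 *\<^sub>R v \<sigma>" "0 \<le> \<sigma>" if "\<sigma> \<in> singular_values B" for \<sigma>
    using someI_ex[of "\<lambda>v. v \<noteq> 0 \<and> M *v v = \<sigma>\<^sup>2 *\<^sub>R v"] that
    unfolding singular_values_def M_def[symmetric] v_def by auto
  have orth: "inner (v \<sigma>) (v \<tau>) = 0"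
    if "\<sigma> \<in> singular_values B" "\<tau> \<in> singular_values B" "\<sigma> \<noteq> \<tau>" for \<sigma> \<tau>
  proof -
    have "\<sigma>\<^sup>2 * inner (v \<sigma>) (v \<tau>) = \<tau>\<^sup>2 * inner (v \<sigma>) (v \<tau>)"
      using sym[of "v \<sigma>" "v \<tau>"] v that by simp
    moreover have "\<sigma>\<^sup>2 \<noteq> \<tau>\<^sup>2"
      using v(3) that by (simp add: power2_eq_iff_nonneg)
    ultimately show ?thesis by simp
  qed
  have "pairwise orthogonal (v ` singular_values B)"
    unfolding pairwise_def orthogonal_def using orth by blast
  then have "finite (v ` singular_values B)"
    by (rule pairwise_orthogonal_imp_finite)
  moreover have "inj_on v (singular_values B)"
    by (rule inj_onI) (metis orth v(1) inner_eq_zero_iff)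
  ultimately show ?thesis
    by (rule finite_imageD)
qed

definition nuclear_norm :: "real^'n^'m \<Rightarrow> real" where
  "nuclear_norm B =
     (\<Sum>\<sigma>\<in>singular_values B. real (singular_value_multiplicity B \<sigma>) * \<sigma>)"

definition subdifferential :: "('a::real_inner \<Rightarrow> real) \<Rightarrow> 'a \<Rightarrow> 'a set" where
  "subdifferential f x = {g. \<forall>y. f x + inner g (y - x) \<le> f y}"

definition soft_threshold :: "real \<Rightarrow> real^'n^'m \<Rightarrow> real^'n^'m" where
  "soft_threshold \<nu> B = (\<chi> i j. sgn (B $ i $ j) * max 0 (\<bar>B $ i $ j\<bar> - \<nu>))"

text \<open>The set of all minimizers, which need not be a singleton.\<close>

definition prox :: "nat \<Rightarrow> real \<Rightarrow> real^'n^'m \<Rightarrow> (real^'n^'m) set" where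
  "prox p \<nu> B = {L. is_arg_min (\<lambda>L. 1/2 * (norm (L - B))\<^sup>2 + \<nu> * nuclear_norm L)
                               (\<lambda>L. rank L \<le> p) L}"

definition energy ::
  "(real^'n^'m \<Rightarrow> real^'n^'m) \<Rightarrow> real^'n^'m \<Rightarrow> real \<Rightarrow> real \<Rightarrow> real^'n^'m \<Rightarrow> real^'n^'m \<Rightarrow> real" where
  "energy A D lam \<mu> L S =
     1/2 * (norm (A L + S - D))\<^sup>2 + lam * l1_norm S + \<mu> * nuclear_norm L"

definition factor_solution ::
  "real \<Rightarrow> real^'n^'m \<Rightarrow> real^'p^'m \<Rightarrow> real^'p^'n \<Rightarrow> bool" where
  "factor_solution \<nu> B X Y \<longleftrightarrow>
     is_arg_min (\<lambda>(X, Y). 1/2 * (norm (X ** transpose Y - B))\<^sup>2 + \<nu> * nuclear_norm X)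
                (\<lambda>(X, Y). transpose Y ** Y = mat 1) (X, Y)"

text \<open>Limit points of the sequence \<open>z 1, z 2, \<dots>\<close>; the entry \<open>z 0\<close> is not part of it.\<close>

definition seq_limit_point :: "(nat \<Rightarrow> 'a::topological_space) \<Rightarrow> 'a \<Rightarrow> bool" where
  "seq_limit_point z l \<longleftrightarrow>
     (\<exists>r :: nat \<Rightarrow> nat. strict_mono r \<and> (\<forall>j. 1 \<le> r j) \<and> (\<lambda>j. z (r j)) \<longlonglongrightarrow> l)"

text \<open>
  The two nuclear norm subgradients, in the first and in the second inclusion, may differ.
\<close>

definition stationary_point ::
  "(real^'n^'m \<Rightarrow> real^'n^'m) \<Rightarrow> real^'n^'m \<Rightarrow> real \<Rightarrow> real \<Rightarrow>
     real^'p^'m \<Rightarrow> real^'p^'n \<Rightarrow> real^'n^'m \<Rightarrow> bool" where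
  "stationary_point A D lam \<mu> X Y S \<longleftrightarrow>
     (let L = X ** transpose Y;
          R = A L + S - D;
          \<G> = {adjoint A R + \<mu> *\<^sub>R G | G. G \<in> subdifferential nuclear_norm L}
      in 0 \<in> (\<lambda>G. G ** Y) ` \<G> \<and>
         0 \<in> (\<lambda>G. transpose X ** G) ` \<G> \<and>
         0 \<in> {R + lam *\<^sub>R G | G. G \<in> subdifferential l1_norm S})"

end

theory Submission
  imports Defs
begin

text \<open>
  The \<open>S\<close>-step minimizes the energy exactly and the \<open>L\<close>-step minimizes a quadratic majorant of it, so
  one iteration lowers \<open>t\<close> times the energy by at least
  \<open>t/2 \<parallel>S k - S (k+1)\<parallel>\<^sup>2 + (1 - \<kappa>)/2 \<parallel>L (k+1) - L k\<parallel>\<^sup>2\<close> with \<open>\<kappa> = t \<parallel>A\<parallel>\<^sup>2 \<le> 1\<close>. Hence the differences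
  of consecutive \<open>S k\<close> (and, if \<open>\<kappa> < 1\<close>, of consecutive \<open>L k\<close>) vanish and limit points are fixed
  points. At a fixed point \<open>L = X Y\<^sup>T\<close> is also optimal among the matrices \<open>W Y\<^sup>T\<close> and among the
  matrices \<open>X W\<^sup>T\<close>, all of rank at most \<open>p\<close>. On each of these linear families the problem is
  convex, and its optimality condition is one of the two inclusions. The nuclear norm enters only
  through duality: it is the maximum of \<open>G \<mapsto> G \<bullet> Z\<close> over the linear contractions \<open>G\<close>.
\<close>

subsection \<open>Orthonormal eigenbases and the nuclear norm\<close>

lemma orthonormal_expand:
  fixes B :: "'a::euclidean_space set"
  assumes "finite B" "\<And>b c. b \<in> B \<Longrightarrow> c \<in> B \<Longrightarrow> b \<bullet> c = (if b = c then 1 else 0)" "x \<in> span B"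
  shows "x = (\<Sum>b\<in>B. (x \<bullet> b) *\<^sub>R b)"
proof -
  obtain u where u: "x = (\<Sum>b\<in>B. u b *\<^sub>R b)"
    using assms(1,3) by (auto simp: span_finite)
  have "x \<bullet> c = u c" if "c \<in> B" for c
  proof -
    have "x \<bullet> c = (\<Sum>b\<in>B. if b = c then u b else 0)"
      unfolding u inner_sum_left using that assms(2) by (intro sum.cong) auto
    then show ?thesis
      using that assms(1) by simp
  qed
  then show ?thesis
    using u by simp
qed

lemma orthonormal_independent:
  fixes B :: "'a::euclidean_space set"
  assumes "\<And>b c. b \<in> B \<Longrightarrow> c \<in> B \<Longrightarrow> b \<bullet> c = (if b = c then 1 else 0)"
  shows "independent B"
proof (rule pairwise_orthogonal_independent)
  show "pairwise orthogonal B"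
    using assms by (auto simp: pairwise_def orthogonal_def)
  show "0 \<notin> B"
    using assms by force
qed

lemma parseval:
  fixes B :: "'a::euclidean_space set"
  assumes "finite B" "\<And>b c. b \<in> B \<Longrightarrow> c \<in> B \<Longrightarrow> b \<bullet> c = (if b = c then 1 else 0)" "span B = UNIV"
  shows "x \<bullet> y = (\<Sum>b\<in>B. (x \<bullet> b) * (y \<bullet> b))"
proof -
  have "x = (\<Sum>b\<in>B. (x \<bullet> b) *\<^sub>R b)"
    using assms by (intro orthonormal_expand) auto
  then have "x \<bullet> y = (\<Sum>b\<in>B. (x \<bullet> b) *\<^sub>R b) \<bullet> y"
    by simp
  then show ?thesis
    by (simp add: inner_sum_left inner_sum_right inner_commute[of _ y])
qed

section \<open>Spectral decomposition of self-adjoint maps\<close>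

lemma nonneg_quadratic_linear_coeff_0:
  fixes a b :: real
  assumes "\<And>s. 0 \<le> a * s\<^sup>2 - 2 * s * b"
  shows "b = 0"
proof (rule ccontr)
  assume b: "b \<noteq> 0"
  \<comment> \<open>For small \<open>s\<close> the linear term dominates. The test value is
    \<open>s = b / c\<close>; any \<open>c > 0\<close> with \<open>a < 2 * c\<close> would
    do.\<close>
  define c where "c = \<bar>a\<bar> + 1"
  have c: "0 < c" "a < c"
    by (auto simp: c_def)
  have "0 \<le> a * (b / c)\<^sup>2 - 2 * (b / c) * b"
    by (rule assms)
  also have "\<dots> = b\<^sup>2 * (a - 2 * c) / c\<^sup>2"
    using c by (simp add: field_simps power2_eq_square)
  also have "\<dots> < 0"
    using b c by (intro divide_neg_pos mult_pos_neg) auto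
  finally show False
    by simp
qed

text \<open>A maximizer \<open>v\<close> of the Rayleigh quotient over the unit sphere of
  \<open>U\<close> is an eigenvector: as \<open>U\<close> is invariant, the residual
  \<open>f v - l *\<^sub>R v\<close> is an admissible direction of variation, and maximality forces
  it to vanish.\<close>

lemma selfadjoint_unit_eigenvector:
  fixes f :: "'a::euclidean_space \<Rightarrow> 'a"
  assumes "linear f" and sub: "subspace U" and inv: "\<And>x. x \<in> U \<Longrightarrow> f x \<in> U"
    and sym: "\<And>x y. f x \<bullet> y = x \<bullet> f y" and "U \<noteq> {0}"
  obtains v l where "v \<in> U" "norm v = 1" "f v = l *\<^sub>R v"
proof -
  interpret f: linear f by fact
  let ?K = "U \<inter> sphere 0 1"
  obtain u where u: "u \<in> U" "u \<noteq> 0"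
    using assms subspace_0 by blast
  have "compact ?K"
    using closed_subspace[OF sub] by (simp add: closed_Int_compact)
  moreover have "u /\<^sub>R norm u \<in> ?K"
    using u sub by (simp add: subspace_scale)
  then have "?K \<noteq> {}"
    by blast
  moreover have "continuous_on ?K (\<lambda>x. x \<bullet> f x)"
    using linear_continuous_on[of f] \<open>linear f\<close>
    by (intro continuous_intros) (auto simp: linear_conv_bounded_linear)
  ultimately obtain v where v: "v \<in> ?K" and vmax: "\<And>x. x \<in> ?K \<Longrightarrow> x \<bullet> f x \<le> v \<bullet> f v"
    by (meson continuous_attains_sup)
  define l where "l = v \<bullet> f v"
  \<comment> \<open>Homogeneity carries the maximality from the unit sphere to all of
    \<open>U\<close>.\<close>
  have le: "x \<bullet> f x \<le> l * (x \<bullet> x)" if "x \<in> U" for x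
  proof (cases "x = 0")
    case False
    then have "(x /\<^sub>R norm x) \<bullet> f (x /\<^sub>R norm x) \<le> l"
      unfolding l_def using that sub by (intro vmax) (simp add: subspace_scale)
    then show ?thesis
      using False by (simp add: f.scaleR field_simps dot_square_norm power2_eq_square)
  qed auto
  define w where "w = f v - l *\<^sub>R v"
  have vv: "v \<bullet> v = 1"
    using v by (simp add: dot_square_norm)
  have w: "w \<in> U"
    using v inv sub by (simp add: w_def subspace_diff subspace_scale)
  \<comment> \<open>The nonnegative form \<open>l * (x \<bullet> x) - x \<bullet> f x\<close>
    vanishes at \<open>v\<close>. At \<open>v + s *\<^sub>R w\<close> its linear coefficient is a
    multiple of \<open>w \<bullet> w\<close>, because the terms with \<open>w \<bullet> v\<close>
    cancel.\<close>
  have "0 \<le> (l * (w \<bullet> w) - w \<bullet> f w) * s\<^sup>2 - 2 * s * (w \<bullet> w)" for s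
  proof -
    have "v + s *\<^sub>R w \<in> U"
      using v w sub by (simp add: subspace_add subspace_scale)
    then have "0 \<le> l * ((v + s *\<^sub>R w) \<bullet> (v + s *\<^sub>R w)) - (v + s *\<^sub>R w) \<bullet> f (v + s *\<^sub>R w)"
      using le by force
    also have "\<dots> = l + (l * s\<^sup>2) * (w \<bullet> w) + (2 * s * l) * (w \<bullet> v)
        - (l + (2 * s) * (w \<bullet> f v) + s\<^sup>2 * (w \<bullet> f w))"
      using vv sym[of v w]
      by (simp add: f.add f.scaleR inner_simps inner_commute power2_eq_square algebra_simps l_def)
    also have "w \<bullet> f v = w \<bullet> w + l * (w \<bullet> v)"
      by (simp add: w_def inner_simps)
    finally show ?thesis
      by (simp add: algebra_simps)
  qed
  then have "w \<bullet> w = 0"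
    by (rule nonneg_quadratic_linear_coeff_0)
  then have "f v = l *\<^sub>R v"
    by (simp add: w_def)
  with v show thesis
    by (intro that[of v l]) auto
qed

text \<open>Induction on the dimension: self-adjointness makes the orthogonal complement of an
  eigenvector in \<open>U\<close> invariant again. This is why the claim is made for invariant
  subspaces.\<close>

theorem selfadjoint_orthonormal_eigenbasis_subspace:
  fixes f :: "'a::euclidean_space \<Rightarrow> 'a"
  assumes "linear f" and sym: "\<And>x y. f x \<bullet> y = x \<bullet> f y"
    and "subspace U" "\<And>x. x \<in> U \<Longrightarrow> f x \<in> U"
  shows "\<exists>B. finite B \<and> (\<forall>b\<in>B. \<forall>c\<in>B. b \<bullet> c = (if b = c then 1 else 0)) \<and> span B = U
    \<and> (\<forall>b\<in>B. \<exists>l. f b = l *\<^sub>R b)"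
  using assms(3,4)
proof (induction "dim U" arbitrary: U rule: less_induct)
  case less
  note sub = less.prems(1)
  show ?case
  proof (cases "U = {0}")
    case True
    then show ?thesis
      by (intro exI[of _ "{}"]) auto
  next
    case False
    then obtain v l where v: "v \<in> U" "norm v = 1" "f v = l *\<^sub>R v"
      using selfadjoint_unit_eigenvector[OF assms(1) less.prems(1,2) sym] by blast
    have vv: "v \<bullet> v = 1"
      using v by (simp add: dot_square_norm)
    define W where "W = {x \<in> U. v \<bullet> x = 0}"
    have W: "subspace W"
      using sub by (auto simp: W_def subspace_def inner_simps)
    have "v \<notin> W"
      using vv by (simp add: W_def)
    then have "W \<subset> U"
      using v by (auto simp only: W_def)
    then have "dim W < dim U"
      using W sub span_eq_iff by (intro dim_psubset) blast
    moreover have "f x \<in> W" if "x \<in> W" for x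
      using that less.prems(2) sym[of v x] v by (auto simp: W_def)
    ultimately obtain B where B: "finite B" "\<forall>b\<in>B. \<forall>c\<in>B. b \<bullet> c = (if b = c then 1 else 0)"
        "span B = W" "\<forall>b\<in>B. \<exists>l. f b = l *\<^sub>R b"
      using less.hyps[of W] W by blast
    have BW: "b \<bullet> v = 0 \<and> v \<bullet> b = 0" if "b \<in> B" for b
      using that B(3) span_base[of b B] by (auto simp: W_def inner_commute)
    have "span (insert v B) = U"
    proof
      show "span (insert v B) \<subseteq> U"
        using v B(3) span_superset[of B] sub by (intro span_minimal) (auto simp: W_def)
      show "U \<subseteq> span (insert v B)"
      proof
        fix x assume "x \<in> U"
        then have "x - (v \<bullet> x) *\<^sub>R v \<in> W"
          using v sub vv by (simp add: W_def subspace_diff subspace_scale inner_simps)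
        then show "x \<in> span (insert v B)"
          using B(3) by (auto simp: span_insert)
      qed
    qed
    moreover have "\<forall>b\<in>insert v B. \<forall>c\<in>insert v B. b \<bullet> c = (if b = c then 1 else 0)"
      using B(2) BW vv by force
    ultimately show ?thesis
      using B v by (intro exI[of _ "insert v B"]) auto
  qed
qed

section \<open>Right singular vectors and the nuclear norm\<close>

lemma inner_gram_left:
  fixes Z :: "real^'n^'m"
  shows "((transpose Z ** Z) *v x) \<bullet> y = (Z *v x) \<bullet> (Z *v y)"
  by (metis dot_lmul_matrix inner_commute matrix_vector_mul_assoc transpose_matrix_vector)

lemma inner_gram_right:
  fixes Z :: "real^'n^'m"
  shows "x \<bullet> ((transpose Z ** Z) *v y) = (Z *v x) \<bullet> (Z *v y)"
  by (metis inner_gram_left inner_commute)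

text \<open>Pairing an eigenvector equation of the Gram matrix with \<open>b\<close> identifies the
  eigenvalue as \<open>(norm (Z *v b))\<^sup>2\<close>, so singular values become the norms of the
  images of a basis.\<close>

lemma right_singular_basis:
  fixes Z :: "real^'n^'m"
  obtains B where "finite B" "\<And>b c. b \<in> B \<Longrightarrow> c \<in> B \<Longrightarrow> b \<bullet> c = (if b = c then 1 else 0)"
    "span B = UNIV" "\<And>b. b \<in> B \<Longrightarrow> (transpose Z ** Z) *v b = (norm (Z *v b))\<^sup>2 *\<^sub>R b"
proof -
  let ?M = "transpose Z ** Z"
  have "\<exists>B. finite B \<and> (\<forall>b\<in>B. \<forall>c\<in>B. b \<bullet> c = (if b = c then 1 else 0)) \<and> span B = UNIV
    \<and> (\<forall>b\<in>B. \<exists>l. ?M *v b = l *\<^sub>R b)"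
    by (rule selfadjoint_orthonormal_eigenbasis_subspace)
      (simp_all add: inner_gram_left inner_gram_right)
  then obtain B where B: "finite B" "\<And>b c. b \<in> B \<Longrightarrow> c \<in> B \<Longrightarrow> b \<bullet> c = (if b = c then 1 else 0)"
    "span B = UNIV" "\<And>b. b \<in> B \<Longrightarrow> \<exists>l. ?M *v b = l *\<^sub>R b"
    by (elim exE conjE) (rule that, simp_all, metis)
  have "?M *v b = (norm (Z *v b))\<^sup>2 *\<^sub>R b" if "b \<in> B" for b
  proof -
    from B(4)[OF that] obtain l where l: "?M *v b = l *\<^sub>R b" ..
    then have "l = (norm (Z *v b))\<^sup>2"
      using inner_gram_left[of Z b b] B(2)[OF that that] by (simp add: dot_square_norm)
    with l show ?thesis by simp
  qed
  with B(1-3) show thesis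
    by (intro that)
qed

text \<open>The eigenspace of \<open>\<sigma>\<^sup>2\<close> is spanned by the basis vectors with
  image norm \<open>\<sigma>\<close>, so its dimension counts them. Grouping the basis by image norm
  then turns the sum weighted by multiplicities into a sum over the basis.\<close>

lemma nuclear_norm_eq_sum:
  fixes Z :: "real^'n^'m"
  assumes fin: "finite B" and on: "\<And>b c. b \<in> B \<Longrightarrow> c \<in> B \<Longrightarrow> b \<bullet> c = (if b = c then 1 else 0)"
    and sp: "span B = UNIV"
    and eig: "\<And>b. b \<in> B \<Longrightarrow> (transpose Z ** Z) *v b = (norm (Z *v b))\<^sup>2 *\<^sub>R b"
  shows "nuclear_norm Z = (\<Sum>b\<in>B. norm (Z *v b))"
proof -
  let ?M = "transpose Z ** Z"
  let ?s = "\<lambda>b. norm (Z *v b)"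
  have exp: "x = (\<Sum>b\<in>B. (x \<bullet> b) *\<^sub>R b)" for x
    using fin on sp by (intro orthonormal_expand) auto
  \<comment> \<open>Moving the symmetric Gram matrix across the inner product shows that an
    eigenvector has a nonzero coordinate along \<open>b\<close> only if the eigenvalues
    agree.\<close>
  have coord: "(x \<bullet> b) * ((?s b)\<^sup>2 - \<sigma>\<^sup>2) = 0"
    if "?M *v x = \<sigma>\<^sup>2 *\<^sub>R x" "b \<in> B" for x b \<sigma>
  proof -
    have "x \<bullet> (?M *v b) = (?M *v x) \<bullet> b"
      by (simp add: inner_gram_left inner_gram_right)
    then show ?thesis
      using eig that by (simp add: algebra_simps)
  qed
  have eigenspace: "{x. ?M *v x = \<sigma>\<^sup>2 *\<^sub>R x} = span {b\<in>B. ?s b = \<sigma>}" if "0 \<le> \<sigma>" for \<sigma>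
  proof
    show "span {b\<in>B. ?s b = \<sigma>} \<subseteq> {x. ?M *v x = \<sigma>\<^sup>2 *\<^sub>R x}"
      using eig
      by (intro span_minimal) (auto simp: subspace_def matrix_vector_right_distrib scaleR_add_right
          matrix_vector_mult_scaleR)
    show "{x. ?M *v x = \<sigma>\<^sup>2 *\<^sub>R x} \<subseteq> span {b\<in>B. ?s b = \<sigma>}"
    proof
      fix x assume "x \<in> {x. ?M *v x = \<sigma>\<^sup>2 *\<^sub>R x}"
      then have "x \<bullet> b = 0 \<or> ?s b = \<sigma>" if "b \<in> B" for b
        using coord[of x \<sigma> b] that \<open>0 \<le> \<sigma>\<close> by (auto simp: power2_eq_iff_nonneg)
      then have "(x \<bullet> b) *\<^sub>R b \<in> span {b\<in>B. ?s b = \<sigma>}" if "b \<in> B" for b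
        using that by (cases "?s b = \<sigma>") (force intro: span_scale span_base simp: span_zero)+
      then show "x \<in> span {b\<in>B. ?s b = \<sigma>}"
        by (subst exp) (rule span_sum)
    qed
  qed
  have sv: "singular_values Z = ?s ` B"
  proof
    show "?s ` B \<subseteq> singular_values Z"
    proof clarify
      fix b assume "b \<in> B"
      moreover from this have "b \<noteq> 0"
        using on[of b b] by auto
      ultimately show "?s b \<in> singular_values Z"
        using eig unfolding singular_values_def by auto
    qed
    show "singular_values Z \<subseteq> ?s ` B"
    proof
      fix \<sigma> assume "\<sigma> \<in> singular_values Z"
      then obtain v where v: "0 \<le> \<sigma>" "v \<noteq> 0" "?M *v v = \<sigma>\<^sup>2 *\<^sub>R v"
        by (auto simp: singular_values_def)
      then have "v \<in> span {b\<in>B. ?s b = \<sigma>}"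
        using eigenspace by blast
      \<comment> \<open>Otherwise the span would be that of the empty set, and \<open>v\<close>
        would be \<open>0\<close>.\<close>
      with v(2) show "\<sigma> \<in> ?s ` B"
        by (metis (mono_tags, lifting) Collect_empty_eq image_eqI singletonD span_empty)
    qed
  qed
  have mult: "singular_value_multiplicity Z \<sigma> = card {b\<in>B. ?s b = \<sigma>}" if "0 \<le> \<sigma>" for \<sigma>
  proof -
    have "independent {b\<in>B. ?s b = \<sigma>}"
      using orthonormal_independent[OF on] by (rule independent_mono) auto
    then show ?thesis
      using eigenspace[OF that] by (simp add: singular_value_multiplicity_def dim_eq_card_independent)
  qed
  have "nuclear_norm Z = (\<Sum>\<sigma>\<in>?s ` B. \<Sum>b\<in>{b\<in>B. ?s b = \<sigma>}. ?s b)"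
    unfolding nuclear_norm_def sv by (rule sum.cong) (auto simp: mult)
  also have "\<dots> = (\<Sum>b\<in>B. ?s b)"
    using fin by (rule sum.image_gen[symmetric])
  finally show ?thesis .
qed

section \<open>Duality between the nuclear norm and contractions\<close>

lemma inner_matrix_orthonormal:
  fixes G Z :: "real^'n^'m"
  assumes "finite B" "\<And>b c. b \<in> B \<Longrightarrow> c \<in> B \<Longrightarrow> b \<bullet> c = (if b = c then 1 else 0)" "span B = UNIV"
  shows "G \<bullet> Z = (\<Sum>b\<in>B. (G *v b) \<bullet> (Z *v b))"
proof -
  have "G \<bullet> Z = (\<Sum>i\<in>UNIV. \<Sum>b\<in>B. (G $ i \<bullet> b) * (Z $ i \<bullet> b))"
    unfolding inner_vec_def[of G Z] by (intro sum.cong refl parseval assms)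
  also have "\<dots> = (\<Sum>b\<in>B. \<Sum>i\<in>UNIV. (G $ i \<bullet> b) * (Z $ i \<bullet> b))"
    by (rule sum.swap)
  finally show ?thesis
    by (simp add: inner_vec_def[of "G *v _"] matrix_vector_mul_component)
qed

text \<open>In a right singular basis of \<open>Z\<close> this is Cauchy-Schwarz, term by
  term.\<close>

lemma inner_le_nuclear_norm:
  fixes G Z :: "real^'n^'m"
  assumes "\<And>v. norm (G *v v) \<le> norm v"
  shows "G \<bullet> Z \<le> nuclear_norm Z"
proof -
  obtain B where B: "finite B" "\<And>b c. b \<in> B \<Longrightarrow> c \<in> B \<Longrightarrow> b \<bullet> c = (if b = c then 1 else 0)"
    "span B = UNIV" "\<And>b. b \<in> B \<Longrightarrow> (transpose Z ** Z) *v b = (norm (Z *v b))\<^sup>2 *\<^sub>R b"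
    using right_singular_basis[of Z] by blast
  have "(G *v b) \<bullet> (Z *v b) \<le> norm (Z *v b)" if "b \<in> B" for b
  proof -
    have "norm b = 1"
      using B(2)[OF that that] by (simp add: norm_eq_1)
    then have "norm (G *v b) * norm (Z *v b) \<le> 1 * norm (Z *v b)"
      using assms[of b] by (intro mult_right_mono) auto
    then show ?thesis
      using norm_cauchy_schwarz[of "G *v b" "Z *v b"] by simp
  qed
  then show ?thesis
    by (simp add: nuclear_norm_eq_sum[OF B] inner_matrix_orthonormal[OF B(1-3)] sum_mono)
qed

text \<open>The maximizer is the partial isometry of the polar decomposition: it sends a right
  singular vector \<open>b\<close> to the normalized \<open>Z *v b\<close> and kills the kernel of
  \<open>Z\<close>. It is a contraction because the images \<open>Z *v b\<close> are mutually
  orthogonal.\<close>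

lemma nuclear_norm_attained:
  fixes Z :: "real^'n^'m"
  obtains G :: "real^'n^'m" where "\<And>v. norm (G *v v) \<le> norm v" "G \<bullet> Z = nuclear_norm Z"
proof -
  obtain B where B: "finite B" "\<And>b c. b \<in> B \<Longrightarrow> c \<in> B \<Longrightarrow> b \<bullet> c = (if b = c then 1 else 0)"
    "span B = UNIV" "\<And>b. b \<in> B \<Longrightarrow> (transpose Z ** Z) *v b = (norm (Z *v b))\<^sup>2 *\<^sub>R b"
    using right_singular_basis[of Z] by blast
  let ?s = "\<lambda>b. norm (Z *v b)"
  \<comment> \<open>\<open>inverse 0 = 0\<close>, so basis vectors in the kernel of \<open>Z\<close> do not contribute.\<close>
  define g where "g v = (\<Sum>b\<in>B. (v \<bullet> b) *\<^sub>R (Z *v b) /\<^sub>R ?s b)" for v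
  have "linear g"
    by (rule linearI) (simp_all add: g_def inner_simps scaleR_add_left scaleR_add_right sum.distrib
        scaleR_sum_right ac_simps)
  then have G: "matrix g *v v = g v" for v
    by simp
  have Zon: "(Z *v b) \<bullet> (Z *v c) = (if b = c then (?s b)\<^sup>2 else 0)" if "b \<in> B" "c \<in> B" for b c
    using inner_gram_left[of Z b c] that
    by (auto simp: B dot_square_norm)
  have gg: "(norm (g v))\<^sup>2 \<le> (norm v)\<^sup>2" for v
  proof -
    have "(norm (g v))\<^sup>2 = (\<Sum>b\<in>B. \<Sum>c\<in>B. (v \<bullet> b) * (v \<bullet> c) * ((Z *v c) \<bullet> (Z *v b)) / (?s b * ?s c))"
      by (simp add: power2_norm_eq_inner g_def inner_sum_left inner_sum_right divide_inverse ac_simps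
          sum_distrib_left)
    \<comment> \<open>Only diagonal terms survive; the quotient is \<open>1\<close>, or
      \<open>0\<close> if \<open>Z *v b = 0\<close>.\<close>
    also have "\<dots> = (\<Sum>b\<in>B. \<Sum>c\<in>B. if b = c then (v \<bullet> b)\<^sup>2 * ((?s b)\<^sup>2 / (?s b)\<^sup>2) else 0)"
      by (intro sum.cong refl) (auto simp: Zon power2_eq_square)
    also have "\<dots> = (\<Sum>b\<in>B. (v \<bullet> b)\<^sup>2 * ((?s b)\<^sup>2 / (?s b)\<^sup>2))"
      using B(1) by simp
    also have "\<dots> \<le> (\<Sum>b\<in>B. (v \<bullet> b)\<^sup>2)"
      by (intro sum_mono) (auto simp: divide_self_if)
    also have "\<dots> = (norm v)\<^sup>2"
      using parseval[OF B(1-3), of v v] by (simp add: dot_square_norm power2_eq_square)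
    finally show ?thesis .
  qed
  have gb: "g b = (Z *v b) /\<^sub>R ?s b" if "b \<in> B" for b
  proof -
    have "g b = (\<Sum>c\<in>B. if b = c then (Z *v b) /\<^sub>R ?s b else 0)"
      unfolding g_def using that by (intro sum.cong refl) (auto simp: B(2))
    then show ?thesis
      using that B(1) by simp
  qed
  show thesis
  proof (rule that[of "matrix g"])
    show "norm (matrix g *v v) \<le> norm v" for v
      unfolding G using gg[of v] by simp
    have "g b \<bullet> (Z *v b) = ?s b" if "b \<in> B" for b
      using that by (cases "Z *v b = 0") (simp_all add: gb dot_square_norm power2_eq_square)
    then show "matrix g \<bullet> Z = nuclear_norm Z"
      by (simp add: nuclear_norm_eq_sum[OF B] inner_matrix_orthonormal[OF B(1-3)] G)
  qed
qed

text \<open>The Frobenius norm dominates the operator norm, so \<open>Z /\<^sub>R norm Z\<close> is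
  a contraction with which the duality can be tested. The bound makes the nuclear term of the energy
  coercive.\<close>

lemma norm_le_nuclear_norm: "norm Z \<le> nuclear_norm Z" for Z :: "real^'n^'m"
proof (cases "Z = 0")
  case True
  then show ?thesis
    using inner_le_nuclear_norm[of 0 Z] by simp
next
  case False
  have "norm (Z *v v) \<le> norm Z * norm v" for v
  proof -
    have "norm (Z *v v) \<le> L2_set (\<lambda>i. norm (Z $ i) * norm v) UNIV"
      unfolding norm_vec_def[of "Z *v v"]
      by (rule L2_set_mono) (auto simp: matrix_vector_mul_component Cauchy_Schwarz_ineq2)
    then show ?thesis
      by (simp add: norm_vec_def[of Z] L2_set_left_distrib)
  qed
  then have "(Z /\<^sub>R norm Z) \<bullet> Z \<le> nuclear_norm Z"
    using False
    by (intro inner_le_nuclear_norm)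
      (simp add: scaleR_matrix_vector_assoc[symmetric] field_simps)
  then show ?thesis
    using False by (simp add: dot_square_norm power2_eq_square flip: mult.assoc)
qed

lemma subdifferential_nuclear_norm_nonempty: "subdifferential nuclear_norm Z \<noteq> {}"
  for Z :: "real^'n^'m"
proof -
  obtain G :: "real^'n^'m" where "\<And>v. norm (G *v v) \<le> norm v" "G \<bullet> Z = nuclear_norm Z"
    using nuclear_norm_attained[of Z] by blast
  \<comment> \<open>The linear functional given by \<open>G\<close> lies below the nuclear norm
    everywhere and touches it at \<open>Z\<close>.\<close>
  then have "G \<in> subdifferential nuclear_norm Z"
    using inner_le_nuclear_norm[of G] by (simp add: subdifferential_def inner_simps)
  then show ?thesis by blast
qed

text \<open>A crude entrywise bound; only the finiteness of the resulting Lipschitz constant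
  matters.\<close>

lemma norm_le_of_contraction:
  fixes G :: "real^'n^'m"
  assumes "\<And>v. norm (G *v v) \<le> norm v"
  shows "norm G \<le> real CARD('m) * real CARD('n)"
proof -
  have "\<bar>G $ i $ j\<bar> \<le> 1" for i j
  proof -
    have "G $ i $ j = (G *v axis j 1) $ i"
      by (simp add: matrix_vector_mul_component inner_axis)
    also have "\<bar>\<dots>\<bar> \<le> norm (G *v axis j 1)"
      by (rule component_le_norm_cart)
    also have "\<dots> \<le> norm (axis j 1 :: real^'n)"
      by (rule assms)
    finally show ?thesis by simp
  qed
  then have "norm (G $ i) \<le> real CARD('n)" for i
    using norm_le_l1_cart[of "G $ i"] sum_bounded_above[of UNIV "\<lambda>j. \<bar>G $ i $ j\<bar>" 1]
    by fastforce
  then have "(\<Sum>i\<in>UNIV. norm (G $ i)) \<le> real CARD('m) * real CARD('n)"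
    using sum_bounded_above[of UNIV "\<lambda>i. norm (G $ i)" "real CARD('n)"] by simp
  moreover have "norm G \<le> (\<Sum>i\<in>UNIV. norm (G $ i))"
    unfolding norm_vec_def[of G] by (rule L2_set_le_sum) simp
  ultimately show ?thesis
    by (rule order_trans[rotated])
qed

lemma nuclear_norm_Lipschitz: "\<exists>C. C-lipschitz_on UNIV (nuclear_norm :: real^'n^'m \<Rightarrow> real)"
proof -
  let ?C = "real CARD('m) * real CARD('n)"
  have le: "nuclear_norm Z - nuclear_norm W \<le> ?C * norm (Z - W)" for Z W :: "real^'n^'m"
  proof -
    obtain G :: "real^'n^'m" where G: "\<And>v. norm (G *v v) \<le> norm v" "G \<bullet> Z = nuclear_norm Z"
      using nuclear_norm_attained[of Z] by blast
    \<comment> \<open>The contraction optimal for \<open>Z\<close> is merely a competitor for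
      \<open>W\<close>.\<close>
    have "nuclear_norm Z - nuclear_norm W \<le> G \<bullet> (Z - W)"
      using G(2) inner_le_nuclear_norm[OF G(1), of W] by (simp add: inner_simps)
    also have "\<dots> \<le> norm G * norm (Z - W)"
      by (rule norm_cauchy_schwarz)
    also have "\<dots> \<le> ?C * norm (Z - W)"
      using norm_le_of_contraction[OF G(1)] by (intro mult_right_mono) auto
    finally show ?thesis .
  qed
  have "?C-lipschitz_on UNIV (nuclear_norm :: real^'n^'m \<Rightarrow> real)"
  proof (rule lipschitz_onI)
    fix Z W :: "real^'n^'m"
    show "dist (nuclear_norm Z) (nuclear_norm W) \<le> ?C * dist Z W"
      using le[of Z W] le[of W Z] by (simp add: dist_norm norm_minus_commute abs_le_iff)
  qed simp
  then show ?thesis by blast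
qed

subsection \<open>Optimality conditions with subgradients\<close>

lemma norm_add_scaleR_square:
  "(norm (u + h *\<^sub>R v))\<^sup>2 = (norm u)\<^sup>2 + 2 * h * (u \<bullet> v) + h\<^sup>2 * (v \<bullet> v)" for u v :: "'a::real_inner"
  unfolding power2_norm_eq_inner
  by (simp add: inner_add_left inner_add_right inner_commute[of v u] power2_eq_square algebra_simps)

lemma norm_subgradient_le:
  fixes f :: "'a::euclidean_space \<Rightarrow> real"
  assumes "C-lipschitz_on UNIV f" "g \<in> subdifferential f x"
  shows "norm g \<le> C"
proof -
  have "g \<bullet> g \<le> f (x + g) - f x"
    using assms(2) by (auto simp: subdifferential_def dest: spec[of _ "x + g"])
  also have "\<dots> \<le> C * norm g"
    using lipschitz_onD[OF assms(1), of "x + g" x] by (simp add: dist_norm)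
  finally have "norm g * norm g \<le> C * norm g"
    by (simp add: dot_square_norm power2_eq_square)
  then show ?thesis
    using lipschitz_on_nonneg[OF assms(1)] by (cases "g = 0") auto
qed

lemma compact_subdifferential:
  fixes f :: "'a::euclidean_space \<Rightarrow> real"
  assumes "C-lipschitz_on UNIV f"
  shows "compact (subdifferential f x)"
proof -
  have "subdifferential f x = (\<Inter>y. {g. f x + g \<bullet> (y - x) \<le> f y})"
    by (auto simp: subdifferential_def)
  also have "closed \<dots>"
    by (intro closed_INT ballI closed_Collect_le continuous_intros)
  finally have "closed (subdifferential f x)" .
  moreover have "bounded (subdifferential f x)"
    using norm_subgradient_le[OF assms] by (intro boundedI) blast
  ultimately show ?thesis
    by (simp add: compact_eq_bounded_closed)
qed

lemma convex_subdifferential: "convex (subdifferential f x)"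
proof (rule convexI)
  fix g h and u v :: real
  assume "g \<in> subdifferential f x" "h \<in> subdifferential f x" and uv: "0 \<le> u" "0 \<le> v" "u + v = 1"
  then have gh: "f x + g \<bullet> (y - x) \<le> f y" "f x + h \<bullet> (y - x) \<le> f y" for y
    by (auto simp: subdifferential_def)
  have v: "v = 1 - u"
    using uv(3) by simp
  have "u * (f x + a) + v * (f x + b) = f x + (u * a + v * b)"
    and "u * f y + v * f y = f y" for a b y
    by (simp_all add: v algebra_simps)
  moreover have "u * (f x + g \<bullet> (y - x)) + v * (f x + h \<bullet> (y - x)) \<le> u * f y + v * f y" for y
    using gh uv by (intro add_mono mult_left_mono) auto
  ultimately show "u *\<^sub>R g + v *\<^sub>R h \<in> subdifferential f x"
    by (simp add: subdifferential_def inner_add_left)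
qed

text \<open>Stands in for the formula of the directional derivative: subgradients chosen at points
  approaching \<open>x\<close> along \<open>d\<close> are bounded by the Lipschitz constant, and the
  limit of a convergent subsequence is a subgradient at \<open>x\<close>.\<close>

lemma directional_subgradient:
  fixes f :: "'a::euclidean_space \<Rightarrow> real"
  assumes Lip: "C-lipschitz_on UNIV f" and ne: "\<And>y. subdifferential f y \<noteq> {}"
  obtains G h g where "G \<in> subdifferential f x" "\<And>j. (0::real) < h j" "h \<longlonglongrightarrow> 0" "g \<longlonglongrightarrow> G"
    "\<And>j::nat. f (x + h j *\<^sub>R d) - f x \<le> h j * (g j \<bullet> d)"
proof -
  define s where "s j = inverse (real (Suc j))" for j
  have s: "s \<longlonglongrightarrow> 0" "\<And>j. 0 < s j"
    unfolding s_def using LIMSEQ_inverse_real_of_nat by auto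
  have "\<exists>g. \<forall>j. g j \<in> subdifferential f (x + s j *\<^sub>R d)"
    using ne by (intro choice) blast
  then obtain g where g: "\<And>j. g j \<in> subdifferential f (x + s j *\<^sub>R d)"
    by blast
  have "bounded (range g)"
    using norm_subgradient_le[OF Lip g] by (intro boundedI) blast
  then obtain G r where r: "strict_mono r" "(g \<circ> r) \<longlonglongrightarrow> G"
    using bounded_imp_convergent_subsequence by blast
  have sr: "(\<lambda>j. s (r j)) \<longlonglongrightarrow> 0"
    using LIMSEQ_subseq_LIMSEQ[OF s(1) r(1)] by (simp add: o_def)
  have gr: "(\<lambda>j. g (r j)) \<longlonglongrightarrow> G"
    using r(2) by (simp add: o_def)
  have cont: "isCont f x" for x
    using lipschitz_on_continuous_on[OF Lip] by (simp add: continuous_on_eq_continuous_at)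
  have point: "(\<lambda>j. x + s (r j) *\<^sub>R d) \<longlonglongrightarrow> x"
    using sr by (auto intro!: tendsto_eq_intros)
  have "f x + G \<bullet> (y - x) \<le> f y" for y
  proof (rule LIMSEQ_le_const2)
    show "(\<lambda>j. f (x + s (r j) *\<^sub>R d) + g (r j) \<bullet> (y - (x + s (r j) *\<^sub>R d))) \<longlonglongrightarrow> f x + G \<bullet> (y - x)"
      by (intro tendsto_intros isCont_tendsto_compose[OF cont] point gr)
    show "\<exists>N. \<forall>j\<ge>N. f (x + s (r j) *\<^sub>R d) + g (r j) \<bullet> (y - (x + s (r j) *\<^sub>R d)) \<le> f y"
      using g by (auto simp: subdifferential_def)
  qed
  then have "G \<in> subdifferential f x"
    by (simp add: subdifferential_def)
  \<comment> \<open>The subgradient inequality at the displaced point, tested at \<open>x\<close>,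
    bounds the increment from above; a subgradient at \<open>x\<close> would bound it from
    below.\<close>
  moreover have "f (x + s (r j) *\<^sub>R d) - f x \<le> s (r j) * (g (r j) \<bullet> d)" for j
  proof -
    have "f (x + s (r j) *\<^sub>R d) + g (r j) \<bullet> (x - (x + s (r j) *\<^sub>R d)) \<le> f x"
      using g[of "r j"] unfolding subdifferential_def by blast
    then show ?thesis
      by (simp add: inner_diff_right)
  qed
  ultimately show thesis
    using s(2) sr gr by (intro that[of G "\<lambda>j. s (r j)" "\<lambda>j. g (r j)"])
qed

text \<open>
  If no subgradient worked, a separating hyperplane would give a direction \<open>d\<close> in which, by
  \<open>directional_subgradient\<close>, the objective strictly decreases.
\<close>

theorem first_order_condition:
  fixes f :: "'a::euclidean_space \<Rightarrow> real" and T :: "'b::euclidean_space \<Rightarrow> 'a"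
  assumes Lip: "C-lipschitz_on UNIV f" and ne: "\<And>y. subdifferential f y \<noteq> {}"
    and T: "linear T" and c: "0 \<le> c"
    and min: "\<And>w. 1/2 * (norm (T x - B))\<^sup>2 + c * f (T x) \<le> 1/2 * (norm (T w - B))\<^sup>2 + c * f (T w)"
  obtains G where "G \<in> subdifferential f (T x)" "\<And>d. T d \<bullet> (T x - B + c *\<^sub>R G) = 0"
proof -
  interpret T: linear T by fact
  let ?D = "subdifferential f (T x)" and ?u = "T x - B"
  \<comment> \<open>\<open>k G\<close> pulls the candidate gradient back along \<open>T\<close>; it
    vanishes exactly when that gradient is orthogonal to the range of \<open>T\<close>.\<close>
  define k where "k G = adjoint T (?u + c *\<^sub>R G)" for G
  have lin: "linear (adjoint T)"
    by (rule adjoint_linear[OF T])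
  have kd: "k G \<bullet> d = T d \<bullet> (?u + c *\<^sub>R G)" for G d
    by (simp add: k_def adjoint_works[OF T] inner_commute[of _ d])
  have aff: "k ` ?D = (+) (adjoint T ?u) ` (\<lambda>G. adjoint T (c *\<^sub>R G)) ` ?D"
    by (simp add: k_def image_image linear_add[OF lin])
  have lin2: "linear (\<lambda>G. adjoint T (c *\<^sub>R G))"
    using linear_compose[OF linear_scaleR lin] by (simp add: o_def)
  have "0 \<in> k ` ?D"
  proof (rule ccontr)
    assume "0 \<notin> k ` ?D"
    moreover have "convex (k ` ?D)"
      unfolding aff by (intro convex_translation convex_linear_image lin2 convex_subdifferential)
    \<comment> \<open>Compactness makes the image closed, so its separation from \<open>0\<close>
      has a positive margin \<open>b\<close>.\<close>
    moreover have "compact (k ` ?D)"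
      unfolding aff using lin2
      by (intro compact_translation compact_continuous_image compact_subdifferential[OF Lip]
          linear_continuous_on) (simp add: linear_conv_bounded_linear)
    ultimately obtain a b where ab: "0 < b" "\<And>G. G \<in> ?D \<Longrightarrow> a \<bullet> k G > b"
      using separating_hyperplane_closed_0[of "k ` ?D"] compact_imp_closed by blast
    obtain G h g where G: "G \<in> ?D" "\<And>j. (0::real) < h j" "h \<longlonglongrightarrow> 0" "g \<longlonglongrightarrow> G"
      "\<And>j::nat. f (T x + h j *\<^sub>R T (- a)) - f (T x) \<le> h j * (g j \<bullet> T (- a))"
      using directional_subgradient[OF Lip ne, of "T x" "T (- a)"] by blast
    let ?v = "T (- a)"
    \<comment> \<open>Minimality along the ray in direction \<open>- a\<close>, divided by
      \<open>h j > 0\<close>.\<close>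
    have "0 \<le> ?u \<bullet> ?v + h j / 2 * (?v \<bullet> ?v) + c * (g j \<bullet> ?v)" for j
    proof -
      have "T (x + h j *\<^sub>R (- a)) = T x + h j *\<^sub>R ?v"
        by (simp add: T.add T.scaleR T.diff T.neg)
      then have "1/2 * (norm ?u)\<^sup>2 + c * f (T x)
          \<le> 1/2 * (norm (?u + h j *\<^sub>R ?v))\<^sup>2 + c * f (T x + h j *\<^sub>R ?v)"
        using min[of "x + h j *\<^sub>R (- a)"] by (simp add: algebra_simps)
      also have "(norm (?u + h j *\<^sub>R ?v))\<^sup>2
          = (norm ?u)\<^sup>2 + 2 * h j * (?u \<bullet> ?v) + (h j)\<^sup>2 * (?v \<bullet> ?v)"
        by (rule norm_add_scaleR_square)
      finally have "0 \<le> h j * (?u \<bullet> ?v) + (h j)\<^sup>2 / 2 * (?v \<bullet> ?v)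
          + c * (f (T x + h j *\<^sub>R ?v) - f (T x))"
        by (simp add: algebra_simps)
      also have "\<dots> \<le> h j * (?u \<bullet> ?v) + (h j)\<^sup>2 / 2 * (?v \<bullet> ?v) + c * (h j * (g j \<bullet> ?v))"
        using mult_left_mono[OF G(5) c] by simp
      also have "\<dots> = h j * (?u \<bullet> ?v + h j / 2 * (?v \<bullet> ?v) + c * (g j \<bullet> ?v))"
        by (simp add: algebra_simps power2_eq_square)
      finally show ?thesis
        using G(2)[of j] by (simp add: zero_le_mult_iff)
    qed
    moreover have "(\<lambda>j. ?u \<bullet> ?v + h j / 2 * (?v \<bullet> ?v) + c * (g j \<bullet> ?v))
        \<longlonglongrightarrow> ?u \<bullet> ?v + 0 / 2 * (?v \<bullet> ?v) + c * (G \<bullet> ?v)"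
      by (intro tendsto_intros G) simp
    \<comment> \<open>In the limit the quadratic term disappears, and
      \<open>a \<bullet> k G \<le> 0\<close> contradicts the margin.\<close>
    ultimately have "0 \<le> ?u \<bullet> ?v + 0 / 2 * (?v \<bullet> ?v) + c * (G \<bullet> ?v)"
      using LIMSEQ_le_const by blast
    then have "a \<bullet> k G \<le> 0"
      using kd[of G a] by (simp add: T.neg inner_commute inner_add_right)
    with ab(1) ab(2)[OF G(1)] show False
      by simp
  qed
  then obtain G where "G \<in> ?D" "k G = 0"
    by auto
  with kd[of G] show thesis
    by (intro that[of G]) auto
qed

section \<open>Soft thresholding and the l1 norm\<close>

lemma abs_subgradient_soft:
  fixes c y :: real
  assumes "0 \<le> \<nu>"
  defines "s \<equiv> sgn c * max 0 (\<bar>c\<bar> - \<nu>)"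
  shows "\<nu> * \<bar>s\<bar> + (c - s) * (y - s) \<le> \<nu> * \<bar>y\<bar>"
proof (cases "\<bar>c\<bar> \<le> \<nu>")
  case True
  \<comment> \<open>Here \<open>s = 0\<close>, and \<open>c\<close> itself is \<open>\<nu>\<close>
    times a subgradient of the absolute value at \<open>0\<close>.\<close>
  have "c * y \<le> \<bar>c\<bar> * \<bar>y\<bar>"
    using abs_ge_self[of "c * y"] by (simp add: abs_mult)
  also have "\<dots> \<le> \<nu> * \<bar>y\<bar>"
    using True by (rule mult_right_mono) simp
  finally have "c * y \<le> \<nu> * \<bar>y\<bar>" .
  moreover have "s = 0"
    using True by (simp add: s_def)
  ultimately show ?thesis
    by simp
next
  case False
  \<comment> \<open>Here \<open>s\<close> is nonzero with the sign of \<open>c\<close>, and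
    \<open>c - s\<close> is \<open>\<nu>\<close> times that sign, the derivative of the absolute
    value at \<open>s\<close>.\<close>
  then have s: "s = sgn c * (\<bar>c\<bar> - \<nu>)" "c \<noteq> 0"
    using assms by (auto simp: s_def)
  then have "c - s = \<nu> * sgn c" "\<bar>s\<bar> = sgn c * s"
    using False by (auto simp: sgn_if algebra_simps abs_mult)
  then have "\<nu> * \<bar>s\<bar> + (c - s) * (y - s) = \<nu> * (sgn c * y)"
    by (simp only:) (simp add: algebra_simps)
  moreover have "\<nu> * (sgn c * y) \<le> \<nu> * \<bar>y\<bar>"
    using assms(1) by (intro mult_left_mono) (auto simp: sgn_if)
  ultimately show ?thesis
    by simp
qed

lemma soft_threshold_subgradient:
  fixes C W :: "real^'n^'m"
  assumes "0 \<le> \<nu>"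
  defines "S \<equiv> soft_threshold \<nu> C"
  shows "\<nu> * l1_norm S + (C - S) \<bullet> (W - S) \<le> \<nu> * l1_norm W"
proof -
  have "\<nu> * l1_norm S + (C - S) \<bullet> (W - S)
      = (\<Sum>i\<in>UNIV. \<Sum>j\<in>UNIV. \<nu> * \<bar>S $ i $ j\<bar> + (C $ i $ j - S $ i $ j) * (W $ i $ j - S $ i $ j))"
    by (simp add: l1_norm_def inner_vec_def sum_distrib_left sum.distrib)
  also have "\<dots> \<le> (\<Sum>i\<in>UNIV. \<Sum>j\<in>UNIV. \<nu> * \<bar>W $ i $ j\<bar>)"
    unfolding S_def soft_threshold_def using abs_subgradient_soft[OF assms(1)]
    by (intro sum_mono) simp
  finally show ?thesis
    by (simp add: l1_norm_def sum_distrib_left)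
qed

text \<open>Besides minimality this records the strong convexity of the quadratic: the surplus
  \<open>1/2 * (norm (W - S))\<^sup>2\<close> is what later drives consecutive \<open>S k\<close>
  together.\<close>

lemma soft_threshold_strong_minimum:
  fixes C W :: "real^'n^'m"
  assumes "0 \<le> \<nu>"
  defines "S \<equiv> soft_threshold \<nu> C"
  shows "1/2 * (norm (S - C))\<^sup>2 + \<nu> * l1_norm S + 1/2 * (norm (W - S))\<^sup>2
    \<le> 1/2 * (norm (W - C))\<^sup>2 + \<nu> * l1_norm W"
proof -
  have "(norm (W - C))\<^sup>2 = (norm (S - C))\<^sup>2 - 2 * ((C - S) \<bullet> (W - S)) + (norm (W - S))\<^sup>2"
    by (simp add: power2_norm_eq_inner inner_diff_left inner_diff_right inner_commute algebra_simps)
  then show ?thesis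
    using soft_threshold_subgradient[OF assms(1), of C W] by (simp add: S_def algebra_simps)
qed

lemma tendsto_soft_threshold:
  fixes C :: "real^'n^'m"
  assumes "0 \<le> \<nu>" and lim: "(Z \<longlongrightarrow> C) F"
  shows "((\<lambda>k. soft_threshold \<nu> (Z k)) \<longlongrightarrow> soft_threshold \<nu> C) F"
proof -
  \<comment> \<open>Thresholding subtracts the projection of \<open>c\<close> onto the interval from
    \<open>- \<nu>\<close> to \<open>\<nu>\<close>; this form avoids the discontinuous
    \<open>sgn\<close>.\<close>
  have eq: "sgn c * max 0 (\<bar>c\<bar> - \<nu>) = c - max (- \<nu>) (min \<nu> c)" for c :: real
    using assms(1) by (auto simp: sgn_if max_def min_def)
  show ?thesis
    unfolding soft_threshold_def eq
    by (intro tendsto_vec_lambda tendsto_intros tendsto_vec_nth lim)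
qed

lemma norm_le_l1_norm: "norm S \<le> l1_norm S" for S :: "real^'n^'m"
proof -
  have "norm S \<le> (\<Sum>i\<in>UNIV. norm (S $ i))"
    unfolding norm_vec_def[of S] by (rule L2_set_le_sum) simp
  also have "\<dots> \<le> l1_norm S"
    unfolding l1_norm_def by (intro sum_mono norm_le_l1_cart)
  finally show ?thesis .
qed

subsection \<open>The proximal iteration\<close>

lemma linear_mult_transpose_right: "linear (\<lambda>W :: real^'p^'m. W ** transpose Y)"
  for Y :: "real^'p^'n"
  by (rule linearI) (simp_all add: vec_eq_iff matrix_matrix_mult_def sum.distrib distrib_right
      sum_distrib_left mult.assoc)

lemma linear_mult_transpose_left: "linear (\<lambda>W :: real^'p^'n. X ** transpose W)"
  for X :: "real^'p^'m"
  by (rule linearI) (simp_all add: vec_eq_iff matrix_matrix_mult_def transpose_def sum.distrib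
      distrib_left sum_distrib_left ac_simps)

text \<open>Cyclicity of the trace. It exhibits the adjoint of
  \<open>W \<mapsto> W ** transpose Y\<close>, so that orthogonality to all such products becomes a
  matrix equation.\<close>

lemma inner_mult_transpose_right: "(X ** transpose Y) \<bullet> M = X \<bullet> (M ** Y)"
  for X :: "real^'p^'m" and Y :: "real^'p^'n"
  unfolding inner_matrix_trace
  by (simp add: matrix_transpose_mul matrix_mul_assoc) (metis matrix_mul_assoc trace_mul_sym)

lemma inner_mult_transpose_left: "(X ** transpose Y) \<bullet> M = transpose Y \<bullet> (transpose X ** M)"
  for X :: "real^'p^'m" and Y :: "real^'p^'n"
  unfolding inner_matrix_trace by (simp add: matrix_transpose_mul matrix_mul_assoc)

lemma tendsto_mult_transpose:
  fixes X :: "'a \<Rightarrow> real^'p^'m" and Y :: "'a \<Rightarrow> real^'p^'n"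
  assumes "(X \<longlongrightarrow> X') F" "(Y \<longlongrightarrow> Y') F"
  shows "((\<lambda>k. X k ** transpose (Y k)) \<longlongrightarrow> X' ** transpose Y') F"
  unfolding matrix_matrix_mult_def transpose_def
  using assms by (auto intro!: tendsto_vec_lambda tendsto_sum tendsto_mult tendsto_vec_nth)

lemma rank_mult_transpose_le: "rank (X ** transpose Y) \<le> CARD('p)"
  for X :: "real^'p^'m" and Y :: "real^'p^'n"
  using rank_mul_le_left[of X "transpose Y"] rank_bound[of X] by simp

text \<open>Bounded factors take the place of semicontinuity of the rank: along a subsequence the
  factors converge, so the limit factors through the same inner dimension.\<close>

lemma rank_limit_le:
  fixes X :: "nat \<Rightarrow> real^'p^'m" and Y :: "nat \<Rightarrow> real^'p^'n"
  assumes "bounded (range (\<lambda>j. (X j, Y j)))" and lim: "(\<lambda>j. X j ** transpose (Y j)) \<longlonglongrightarrow> L"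
  shows "rank L \<le> CARD('p)"
proof -
  obtain z r where r: "strict_mono r" and z: "((\<lambda>j. (X j, Y j)) \<circ> r) \<longlonglongrightarrow> z"
    using bounded_imp_convergent_subsequence[OF assms(1)] by blast
  have "(\<lambda>j. X (r j)) \<longlonglongrightarrow> fst z" "(\<lambda>j. Y (r j)) \<longlonglongrightarrow> snd z"
    using tendsto_fst[OF z] tendsto_snd[OF z] by (simp_all add: o_def)
  then have "(\<lambda>j. X (r j) ** transpose (Y (r j))) \<longlonglongrightarrow> fst z ** transpose (snd z)"
    by (rule tendsto_mult_transpose)
  then have "L = fst z ** transpose (snd z)"
    using LIMSEQ_subseq_LIMSEQ[OF lim r] by (intro LIMSEQ_unique) (auto simp: o_def)
  then show ?thesis
    by (simp add: rank_mult_transpose_le)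
qed

section \<open>Proximal points, descent and fixed points\<close>

lemma mem_prox_iff:
  "L \<in> prox p \<nu> B \<longleftrightarrow> rank L \<le> p \<and> (\<forall>W. rank W \<le> p \<longrightarrow>
    1/2 * (norm (L - B))\<^sup>2 + \<nu> * nuclear_norm L \<le> 1/2 * (norm (W - B))\<^sup>2 + \<nu> * nuclear_norm W)"
  by (simp add: prox_def is_arg_min_linorder)

lemma isCont_nuclear_norm: "isCont nuclear_norm Z" for Z :: "real^'n^'m"
proof -
  obtain C where "C-lipschitz_on UNIV (nuclear_norm :: real^'n^'m \<Rightarrow> real)"
    using nuclear_norm_Lipschitz by blast
  then have "continuous_on UNIV (nuclear_norm :: real^'n^'m \<Rightarrow> real)"
    by (rule lipschitz_on_continuous_on)
  then show ?thesis
    by (simp add: continuous_on_eq_continuous_at)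
qed

text \<open>Minimality against each fixed competitor \<open>W\<close> is an inequality between
  continuous expressions, hence survives limits.\<close>

lemma prox_limit:
  fixes L :: "nat \<Rightarrow> real^'n^'m"
  assumes prox: "\<And>j. L j \<in> prox p \<nu> (B j)" and L: "L \<longlonglongrightarrow> L'" and B: "B \<longlonglongrightarrow> B'" and rank: "rank L' \<le> p"
  shows "L' \<in> prox p \<nu> B'"
proof -
  have "1/2 * (norm (L' - B'))\<^sup>2 + \<nu> * nuclear_norm L' \<le> 1/2 * (norm (W - B'))\<^sup>2 + \<nu> * nuclear_norm W"
    if "rank W \<le> p" for W
  proof (rule LIMSEQ_le)
    show "(\<lambda>j. 1/2 * (norm (L j - B j))\<^sup>2 + \<nu> * nuclear_norm (L j))
        \<longlonglongrightarrow> 1/2 * (norm (L' - B'))\<^sup>2 + \<nu> * nuclear_norm L'"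
      by (intro tendsto_intros isCont_tendsto_compose[OF isCont_nuclear_norm] L B)
    show "(\<lambda>j. 1/2 * (norm (W - B j))\<^sup>2 + \<nu> * nuclear_norm W)
        \<longlonglongrightarrow> 1/2 * (norm (W - B'))\<^sup>2 + \<nu> * nuclear_norm W"
      by (intro tendsto_intros B)
    show "\<exists>N. \<forall>j\<ge>N. 1/2 * (norm (L j - B j))\<^sup>2 + \<nu> * nuclear_norm (L j)
        \<le> 1/2 * (norm (W - B j))\<^sup>2 + \<nu> * nuclear_norm W"
      using prox that by (simp add: mem_prox_iff)
  qed
  with rank show ?thesis
    by (simp add: mem_prox_iff)
qed

text \<open>The old point \<open>L\<close> is admissible in the proximal problem, so minimality is
  tested against it. The data term is expanded exactly, and its linear part matches the cross term
  of the proximal square. Scaling the energy by \<open>t\<close> avoids division.\<close>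

lemma prox_gradient_descent:
  fixes A :: "real^'n^'m \<Rightarrow> real^'n^'m"
  assumes "linear A" "rank L \<le> p"
    and prox: "L' \<in> prox p (t * \<mu>) (L - t *\<^sub>R adjoint A (A L + S - D))"
  shows "t * energy A D lam \<mu> L' S + 1/2 * (norm (L' - L))\<^sup>2
    \<le> t * energy A D lam \<mu> L S + t/2 * (norm (A (L' - L)))\<^sup>2"
proof -
  interpret A: linear A by fact
  define R where "R = A L + S - D"
  define V where "V = L' - L"
  let ?g = "adjoint A R"
  have "1/2 * (norm (V + t *\<^sub>R ?g))\<^sup>2 + t * \<mu> * nuclear_norm L'
      \<le> 1/2 * (norm (t *\<^sub>R ?g))\<^sup>2 + t * \<mu> * nuclear_norm L"
    using prox assms(2) by (auto simp: mem_prox_iff V_def R_def algebra_simps dest: spec[of _ L])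
  moreover have "(norm (V + t *\<^sub>R ?g))\<^sup>2 = (norm V)\<^sup>2 + 2 * t * (V \<bullet> ?g) + (norm (t *\<^sub>R ?g))\<^sup>2"
    unfolding norm_add_scaleR_square by (simp add: power_mult_distrib dot_square_norm)
  moreover have "V \<bullet> ?g = R \<bullet> A V"
    by (simp add: adjoint_works[OF assms(1)] inner_commute)
  moreover have "(norm (A L' + S - D))\<^sup>2 = (norm R)\<^sup>2 + 2 * (R \<bullet> A V) + (norm (A V))\<^sup>2"
    using norm_add_scaleR_square[of R 1 "A V"]
    by (simp add: R_def V_def A.diff dot_square_norm algebra_simps)
  ultimately show ?thesis
    unfolding energy_def R_def[symmetric] V_def[symmetric] by (simp add: algebra_simps)
qed

lemma energy_soft_threshold:
  fixes A :: "real^'n^'m \<Rightarrow> real^'n^'m"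
  assumes "0 \<le> lam"
  shows "energy A D lam \<mu> L (soft_threshold lam (D - A L))
      + 1/2 * (norm (S - soft_threshold lam (D - A L)))\<^sup>2 \<le> energy A D lam \<mu> L S"
proof -
  have eq: "A L + W - D = W - (D - A L)" for W
    by simp
  show ?thesis
    using soft_threshold_strong_minimum[OF assms, of "D - A L" S] by (simp add: energy_def eq)
qed

text \<open>The decreasing sequence \<open>e\<close> converges, so its decrements vanish, and they
  dominate \<open>a\<close>.\<close>

lemma descent_gap_tendsto_0:
  fixes e a :: "nat \<Rightarrow> real"
  assumes "\<And>k. 0 \<le> a k" "\<And>k. 0 \<le> e k" "\<And>k. e (Suc k) + a k \<le> e k"
  shows "a \<longlonglongrightarrow> 0"
proof -
  have "e (Suc k) \<le> e k" for k
    using assms(1,3)[of k] by simp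
  then have "decseq e"
    by (rule decseq_SucI)
  then obtain l where l: "e \<longlonglongrightarrow> l"
    using decseq_convergent[of e 0] assms(2) by blast
  have "(\<lambda>k. e k - e (Suc k)) \<longlonglongrightarrow> l - l"
    by (intro tendsto_diff l LIMSEQ_Suc)
  then have lim: "(\<lambda>k. e k - e (Suc k)) \<longlonglongrightarrow> 0"
    by simp
  show ?thesis
    using assms by (intro tendsto_sandwich[OF _ _ tendsto_const lim]) (auto simp: algebra_simps)
qed

lemma prox_fixed_point_stationary:
  fixes A :: "real^'n^'m \<Rightarrow> real^'n^'m" and X :: "real^'p^'m" and Y :: "real^'p^'n"
  assumes A: "linear A" and t: "0 < t" and \<mu>: "0 \<le> \<mu>" and lam: "0 < lam"
  defines "L \<equiv> X ** transpose Y"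
  assumes S: "S = soft_threshold lam (D - A L)"
    and prox: "L \<in> prox CARD('p) (t * \<mu>) (L - t *\<^sub>R adjoint A (A L + S - D))"
  shows "stationary_point A D lam \<mu> X Y S"
proof -
  let ?g = "adjoint A (A L + S - D)"
  let ?B = "L - t *\<^sub>R ?g"
  obtain C where Lip: "C-lipschitz_on UNIV (nuclear_norm :: real^'n^'m \<Rightarrow> real)"
    using nuclear_norm_Lipschitz by blast
  have c: "0 \<le> t * \<mu>"
    using t \<mu> by simp
  \<comment> \<open>The optimality condition of the proximal problem is \<open>t\<close> times that
    of the energy.\<close>
  have orth: "M \<bullet> (?g + \<mu> *\<^sub>R G) = 0" if "M \<bullet> (L - ?B + (t * \<mu>) *\<^sub>R G) = 0" for M G
  proof -
    have "L - ?B + (t * \<mu>) *\<^sub>R G = t *\<^sub>R (?g + \<mu> *\<^sub>R G)"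
      by (simp add: scaleR_add_right)
    then show ?thesis
      using that t by simp
  qed
  \<comment> \<open>Every product with inner dimension \<open>CARD('p)\<close> obeys the rank
    constraint, so it is a legitimate competitor.\<close>
  have min: "1/2 * (norm (L - ?B))\<^sup>2 + t * \<mu> * nuclear_norm L
      \<le> 1/2 * (norm (W ** transpose V - ?B))\<^sup>2 + t * \<mu> * nuclear_norm (W ** transpose V)"
    for W :: "real^'p^'m" and V :: "real^'p^'n"
    using prox rank_mult_transpose_le[of W V] unfolding mem_prox_iff by blast
  \<comment> \<open>The linear map is \<open>W \<mapsto> W ** transpose Y\<close>, with minimizer
    \<open>X\<close>.\<close>
  obtain G where G: "G \<in> subdifferential nuclear_norm L"
    "\<And>W. (W ** transpose Y) \<bullet> (L - ?B + (t * \<mu>) *\<^sub>R G) = 0"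
    using first_order_condition[OF Lip subdifferential_nuclear_norm_nonempty
        linear_mult_transpose_right c, of X Y ?B] min unfolding L_def by blast
  \<comment> \<open>Now the linear map is \<open>W \<mapsto> X ** transpose W\<close>, with
    minimizer \<open>Y\<close>; its subgradient may be a different one.\<close>
  obtain H where H: "H \<in> subdifferential nuclear_norm L"
    "\<And>W. (X ** transpose W) \<bullet> (L - ?B + (t * \<mu>) *\<^sub>R H) = 0"
    using first_order_condition[OF Lip subdifferential_nuclear_norm_nonempty
        linear_mult_transpose_left c, of X Y ?B] min unfolding L_def by blast
  have "W \<bullet> ((?g + \<mu> *\<^sub>R G) ** Y) = 0" for W
    using orth[OF G(2)] by (simp add: inner_mult_transpose_right)
  then have GY: "(?g + \<mu> *\<^sub>R G) ** Y = 0"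
    by (metis inner_eq_zero_iff)
  have "transpose W \<bullet> (transpose X ** (?g + \<mu> *\<^sub>R H)) = 0" for W
    using orth[OF H(2)] by (simp add: inner_mult_transpose_left)
  then have XH: "transpose X ** (?g + \<mu> *\<^sub>R H) = 0"
    by (metis inner_eq_zero_iff transpose_transpose)
  \<comment> \<open>Solves the third inclusion for the subgradient; the thresholding inequality
    divided by \<open>lam\<close> confirms that it is one.\<close>
  define K where "K = (D - A L - S) /\<^sub>R lam"
  have "l1_norm S + K \<bullet> (W - S) \<le> l1_norm W" for W
  proof -
    have "lam * (l1_norm S + K \<bullet> (W - S)) = lam * l1_norm S + (D - A L - S) \<bullet> (W - S)"
      using lam by (simp add: K_def distrib_left)
    also have "\<dots> \<le> lam * l1_norm W"
      using soft_threshold_subgradient[of lam "D - A L" W] lam by (simp add: S)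
    finally show ?thesis
      using lam by simp
  qed
  then have "K \<in> subdifferential l1_norm S"
    by (simp add: subdifferential_def)
  moreover have "0 = A L + S - D + lam *\<^sub>R K"
    using lam by (simp add: K_def)
  ultimately show ?thesis
    using G(1) H(1) GY XH unfolding stationary_point_def Let_def L_def[symmetric]
    by (auto 0 3 simp: image_iff intro: exI[of _ G] exI[of _ H] exI[of _ K])
qed

text \<open>The constant is \<open>t * (onorm A)\<^sup>2\<close>, or \<open>0\<close> for the zero
  operator. That operator is a separate case since \<open>1 / 0 = 0\<close> would exclude every
  positive \<open>t\<close>.\<close>

lemma step_size_contraction:
  fixes A :: "'a::real_normed_vector \<Rightarrow> 'b::real_normed_vector"
  assumes A: "bounded_linear A" and "0 < t" "A = (\<lambda>_. 0) \<or> t < 1 / (onorm A)\<^sup>2"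
  obtains \<kappa> where "\<kappa> < 1" "\<And>V. t * (norm (A V))\<^sup>2 \<le> \<kappa> * (norm V)\<^sup>2"
proof (cases "onorm A = 0")
  case True
  then have "A V = 0" for V
    using onorm_eq_0[OF A] by simp
  then show thesis
    by (intro that[of 0]) auto
next
  case False
  then have pos: "0 < (onorm A)\<^sup>2"
    by simp
  have "A \<noteq> (\<lambda>_. 0)"
    using False onorm_eq_0[OF A] by auto
  then have "t * (onorm A)\<^sup>2 < 1"
    using assms(3) pos by (simp add: field_simps)
  moreover have "t * (norm (A V))\<^sup>2 \<le> t * (onorm A)\<^sup>2 * (norm V)\<^sup>2" for V
  proof -
    have "(norm (A V))\<^sup>2 \<le> (onorm A * norm V)\<^sup>2"
      using onorm[OF A, of V] by (rule power_mono) simp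
    then show ?thesis
      using \<open>0 < t\<close> by (simp add: power_mult_distrib mult.assoc)
  qed
  ultimately show thesis
    by (rule that)
qed

lemma adjoint_id: "adjoint (id :: 'a::euclidean_space \<Rightarrow> 'a) = id"
  by (rule adjoint_unique) simp

lemma seq_limit_point_bounded:
  fixes z :: "nat \<Rightarrow> 'a::heine_borel"
  assumes "bounded (z ` {1..})"
  shows "\<exists>l. seq_limit_point z l"
proof -
  \<comment> \<open>Composing with \<open>Suc\<close> keeps all indices of the subsequence at least
    \<open>1\<close>.\<close>
  have "bounded (range (z \<circ> Suc))"
    using assms by (rule bounded_subset) auto
  then obtain l r where r: "strict_mono r" "((z \<circ> Suc) \<circ> r) \<longlonglongrightarrow> l"
    using bounded_imp_convergent_subsequence by blast
  then have "strict_mono (Suc \<circ> r)" "(\<lambda>j. z ((Suc \<circ> r) j)) \<longlonglongrightarrow> l"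
    by (auto simp: strict_mono_def o_def)
  then show ?thesis
    unfolding seq_limit_point_def by (intro exI[of _ l] exI[of _ "Suc \<circ> r"]) auto
qed

theorem theorem2p4:
  fixes A :: "real^'n^'m \<Rightarrow> real^'n^'m"
    and D :: "real^'n^'m"
    and L S :: "nat \<Rightarrow> real^'n^'m"
    and X :: "nat \<Rightarrow> real^'p^'m"
    and Y :: "nat \<Rightarrow> real^'p^'n"
    and lam \<mu> t :: real
  assumes p_le: "CARD('p) \<le> min CARD('m) CARD('n)"
    and A: "bounded_linear A"
    and lam_pos: "0 < lam"
    and mu: "0 < \<mu> \<or> (\<mu> = 0 \<and> A = id)"
    and t: "(0 < t \<and> (A = (\<lambda>_. 0) \<or> t < 1 / (onorm A)\<^sup>2)) \<or> (A = id \<and> t = 1)"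
    and S_step: "\<And>k. 1 \<le> k \<Longrightarrow> S k = soft_threshold lam (D - A (L (k - 1)))"
    and L_step: "\<And>k. 1 \<le> k \<Longrightarrow>
      L k \<in> prox CARD('p) (t * \<mu>) (L (k - 1) - t *\<^sub>R adjoint A (A (L (k - 1)) + S k - D))"
    and L_factor: "\<And>k. 1 \<le> k \<Longrightarrow> L k = X k ** transpose (Y k)"
    and XY_step: "\<And>k. 1 \<le> k \<Longrightarrow>
      factor_solution (t * \<mu>) (L (k - 1) - t *\<^sub>R adjoint A (A (L (k - 1)) + S k - D)) (X k) (Y k)"
  shows "antimono_on {1..} (\<lambda>k. energy A D lam \<mu> (L k) (S k))
    \<and> (bounded ((\<lambda>k. (L k, S k)) ` {1..})
       \<and> (\<exists>z. seq_limit_point (\<lambda>k. (L k, S k)) z))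
    \<and> (\<forall>L' S'. seq_limit_point (\<lambda>k. (L k, S k)) (L', S') \<longrightarrow>
         S' = soft_threshold lam (D - A L')
         \<and> L' \<in> prox CARD('p) (t * \<mu>) (L' - t *\<^sub>R adjoint A (A L' + S' - D)))
    \<and> (bounded ((\<lambda>k. (X k, Y k, S k)) ` {1..})
       \<and> (\<forall>X' Y' S'. seq_limit_point (\<lambda>k. (X k, Y k, S k)) (X', Y', S') \<longrightarrow>
            seq_limit_point (\<lambda>k. (L k, S k)) (X' ** transpose Y', S')))
    \<and> (\<forall>X' Y' S'. seq_limit_point (\<lambda>k. (X k, Y k, S k)) (X', Y', S') \<longrightarrow>
         stationary_point A D lam \<mu> X' Y' S')"
proof -
  have linA: "linear A"
    using A by (simp add: linear_conv_bounded_linear)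
  have t_pos: "0 < t" and \<mu>_nonneg: "0 \<le> \<mu>"
    using t mu by auto
  \<comment> \<open>The value \<open>1\<close> is used only for the identity with unit step, where
    the \<open>L\<close>-part of the decrease is lost.\<close>
  obtain \<kappa> where \<kappa>: "\<kappa> \<le> 1" "\<And>V. t * (norm (A V))\<^sup>2 \<le> \<kappa> * (norm V)\<^sup>2"
    and \<kappa>_cases: "\<kappa> < 1 \<or> (A = id \<and> t = 1)"
  proof (cases "A = id \<and> t = 1")
    case True
    then show thesis
      by (intro that[of 1]) auto
  next
    case False
    then show thesis
      using step_size_contraction[OF A t_pos] t that by (metis less_imp_le)
  qed
  define E where "E k = energy A D lam \<mu> (L k) (S k)" for k
  have nuc: "0 \<le> nuclear_norm Z" for Z :: "real^'n^'m"
    using norm_le_nuclear_norm[of Z] norm_ge_zero[of Z] by linarith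
  have l1: "0 \<le> l1_norm Z" for Z :: "real^'n^'m"
    using norm_le_l1_norm[of Z] norm_ge_zero[of Z] by linarith
  have E_terms: "0 \<le> (norm (A (L k) + S k - D))\<^sup>2" "0 \<le> lam * l1_norm (S k)"
      "0 \<le> \<mu> * nuclear_norm (L k)" for k
    using nuc l1 lam_pos \<mu>_nonneg by auto
  have E_nonneg: "0 \<le> E k" for k
    using E_terms[of k] by (simp add: E_def energy_def)
  have S_Suc: "S (Suc k) = soft_threshold lam (D - A (L k))" for k
    using S_step[of "Suc k"] by simp
  have L_Suc: "L (Suc k) \<in> prox CARD('p) (t * \<mu>) (L k - t *\<^sub>R adjoint A (A (L k) + S (Suc k) - D))" for k
    using L_step[of "Suc k"] by simp

  \<comment> \<open>Monotone decrease of the energy\<close>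
  define gap where
    "gap k = t/2 * (norm (S k - S (Suc k)))\<^sup>2 + (1 - \<kappa>)/2 * (norm (L (Suc k) - L k))\<^sup>2" for k
  have gap_nonneg: "0 \<le> gap k" for k
    using t_pos \<kappa>(1) by (simp add: gap_def)
  \<comment> \<open>The index starts at \<open>1\<close>: the initial \<open>L 0\<close> may violate
    the rank constraint and then cannot serve as competitor.\<close>
  have descent: "t * E (Suc k) + gap k \<le> t * E k" if "1 \<le> k" for k
  proof -
    have "rank (L k) \<le> CARD('p)"
      using that L_factor rank_mult_transpose_le by metis
    then have "t * E (Suc k) + 1/2 * (norm (L (Suc k) - L k))\<^sup>2
        \<le> t * energy A D lam \<mu> (L k) (S (Suc k)) + t/2 * (norm (A (L (Suc k) - L k)))\<^sup>2"
      unfolding E_def by (rule prox_gradient_descent[OF linA _ L_Suc])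
    \<comment> \<open>The \<open>S\<close>-step acts first, at fixed \<open>L k\<close>; the
      \<open>L\<close>-step then acts at fixed \<open>S (Suc k)\<close>.\<close>
    moreover have "t * (energy A D lam \<mu> (L k) (S (Suc k)) + 1/2 * (norm (S k - S (Suc k)))\<^sup>2) \<le> t * E k"
      unfolding E_def S_Suc using lam_pos t_pos by (intro mult_left_mono energy_soft_threshold) auto
    ultimately show ?thesis
      using \<kappa>(2)[of "L (Suc k) - L k"] by (simp add: gap_def field_simps)
  qed
  have E_Suc: "E (Suc k) \<le> E k" if "1 \<le> k" for k
  proof -
    have "t * E (Suc k) \<le> t * E k"
      using descent[OF that] gap_nonneg[of k] by simp
    then show ?thesis
      using t_pos by simp
  qed
  have E_mono: "E j \<le> E i" if "1 \<le> i" "i \<le> j" for i j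
    using that(2) that(1) by (induction rule: dec_induct) (auto intro: order_trans[OF E_Suc])
  have part1: "antimono_on {1..} E"
    using E_mono by (intro monotone_onI) auto

  \<comment> \<open>Vanishing of consecutive differences\<close>
  have gap_lim: "(\<lambda>k. gap (Suc k)) \<longlonglongrightarrow> 0"
    using gap_nonneg E_nonneg t_pos descent
    by (intro descent_gap_tendsto_0[where e = "\<lambda>k. t * E (Suc k)"]) auto
  \<comment> \<open>Applied to each of the two squares in \<open>gap\<close>; the shift by
    \<open>Suc\<close> leaves out index \<open>0\<close>, where descent is not known.\<close>
  have norm_lim: "f \<longlonglongrightarrow> 0" if "0 < c" "\<And>k. c * (norm (f (Suc k)))\<^sup>2 \<le> gap (Suc k)"
    for f :: "nat \<Rightarrow> real^'n^'m" and c
  proof -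
    have lim: "(\<lambda>k. gap (Suc k) / c) \<longlonglongrightarrow> 0"
      using tendsto_divide[OF gap_lim tendsto_const, of c] that(1) by simp
    have "(\<lambda>k. (norm (f (Suc k)))\<^sup>2) \<longlonglongrightarrow> 0"
      using that by (intro tendsto_sandwich[OF _ _ tendsto_const lim]) (auto simp: field_simps)
    then have "(\<lambda>k. f (Suc k)) \<longlonglongrightarrow> 0"
      using tendsto_real_sqrt[of "\<lambda>k. (norm (f (Suc k)))\<^sup>2"] by (simp add: tendsto_norm_zero_iff)
    then show ?thesis
      by (rule LIMSEQ_imp_Suc)
  qed
  have S_diff: "(\<lambda>k. S k - S (Suc k)) \<longlonglongrightarrow> 0"
    using t_pos \<kappa>(1) by (intro norm_lim[of "t/2"]) (auto simp: gap_def)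
  have L_diff: "(\<lambda>k. L (Suc k) - L k) \<longlonglongrightarrow> 0" if "\<kappa> < 1"
    using t_pos that by (intro norm_lim[of "(1 - \<kappa>)/2"]) (auto simp: gap_def)

  \<comment> \<open>Boundedness of the iterates\<close>
  have S_bound: "norm (S k) \<le> E 1 / lam" if "1 \<le> k" for k
  proof -
    have "lam * norm (S k) \<le> lam * l1_norm (S k)"
      using norm_le_l1_norm lam_pos by (intro mult_left_mono) auto
    also have "\<dots> \<le> E k"
      using E_terms[of k] by (simp add: E_def energy_def)
    also have "\<dots> \<le> E 1"
      using E_mono[of 1 k] that by simp
    finally show ?thesis
      using lam_pos by (simp add: field_simps)
  qed
  obtain K where L_bound: "\<And>k. 1 \<le> k \<Longrightarrow> norm (L k) \<le> K"
  proof (cases "0 < \<mu>")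
    case True
    have "norm (L k) \<le> E 1 / \<mu>" if "1 \<le> k" for k
    proof -
      have "\<mu> * norm (L k) \<le> \<mu> * nuclear_norm (L k)"
        using norm_le_nuclear_norm True by (intro mult_left_mono) auto
      also have "\<dots> \<le> E k"
        using E_terms[of k] by (simp add: E_def energy_def)
      also have "\<dots> \<le> E 1"
        using E_mono[of 1 k] that by simp
      finally show ?thesis
        using True by (simp add: field_simps)
    qed
    then show thesis
      by (rule that)
  next
    case False
    \<comment> \<open>Now \<open>\<mu> = 0\<close>, and \<open>L k\<close> is controlled through the
      residual \<open>L k + S k - D\<close> and the bound on \<open>S k\<close>.\<close>
    then have id: "A = id"
      using mu by simp
    have "norm (L k) \<le> (1 + E 1) + E 1 / lam + norm D" if "1 \<le> k" for k
    proof -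
      let ?R = "L k + S k - D"
      \<comment> \<open>Bounds the norm by its square, so that no square root of the energy
        appears.\<close>
      have "0 \<le> (norm ?R - 1)\<^sup>2"
        by simp
      also have "\<dots> = (norm ?R)\<^sup>2 - 2 * norm ?R + 1"
        by (simp add: power2_eq_square algebra_simps)
      finally have "norm ?R \<le> 1 + 1/2 * (norm ?R)\<^sup>2"
        by simp
      also have "1/2 * (norm ?R)\<^sup>2 \<le> E k"
        using E_terms[of k] by (simp add: E_def energy_def id)
      also have "E k \<le> E 1"
        using E_mono[of 1 k] that by simp
      finally have "norm ?R \<le> 1 + E 1"
        by simp
      moreover have "norm (L k) \<le> norm ?R + norm (S k) + norm D"
        using norm_triangle_ineq4[of "?R + D" "S k"] norm_triangle_ineq[of ?R D] by simp
      ultimately show ?thesis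
        using S_bound[OF that] by simp
    qed
    then show thesis
      by (rule that)
  qed
  have bounded_LS: "bounded ((\<lambda>k. (L k, S k)) ` {1..})"
  proof (rule boundedI)
    fix z assume "z \<in> (\<lambda>k. (L k, S k)) ` {1..}"
    then show "norm z \<le> K + E 1 / lam"
      using L_bound S_bound norm_Pair_le by (fastforce intro: order_trans add_mono)
  qed

  \<comment> \<open>Boundedness of the factors\<close>
  have orthonormal: "transpose (Y k) ** Y k = mat 1" if "1 \<le> k" for k
    using XY_step[OF that] by (simp add: factor_solution_def is_arg_min_def)
  have Y_norm: "norm (Y k) = sqrt (real CARD('p))" if "1 \<le> k" for k
    using orthonormal[OF that] by (simp add: norm_eq_sqrt_inner inner_matrix_trace trace_I)
  have X_norm: "norm (X k) = norm (L k)" if "1 \<le> k" for k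
  proof -
    \<comment> \<open>As \<open>Y k\<close> has orthonormal columns, multiplying by its transpose
      preserves the Frobenius norm.\<close>
    have "L k \<bullet> L k = X k \<bullet> (X k ** (transpose (Y k) ** Y k))"
      by (simp add: L_factor[OF that] inner_mult_transpose_right matrix_mul_assoc)
    then show ?thesis
      by (simp add: orthonormal[OF that] norm_eq_sqrt_inner)
  qed
  have XYS_norm: "norm (X k, Y k) \<le> K + sqrt (real CARD('p))" if "1 \<le> k" for k
    using norm_Pair_le[of "X k" "Y k"] X_norm[OF that] Y_norm[OF that] L_bound[OF that] by simp
  have bounded_XYS: "bounded ((\<lambda>k. (X k, Y k, S k)) ` {1..})"
  proof (rule boundedI)
    fix z assume "z \<in> (\<lambda>k. (X k, Y k, S k)) ` {1..}"
    then obtain k where k: "1 \<le> k" "z = (X k, Y k, S k)"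
      by auto
    have "norm z \<le> norm (X k) + (norm (Y k) + norm (S k))"
      unfolding k(2) using norm_Pair_le[of "X k" "(Y k, S k)"] norm_Pair_le[of "Y k" "S k"] by simp
    then show "norm z \<le> K + (sqrt (real CARD('p)) + E 1 / lam)"
      using X_norm[OF k(1)] Y_norm[OF k(1)] L_bound[OF k(1)] S_bound[OF k(1)] by simp
  qed

  \<comment> \<open>Limit points\<close>
  have part3: "S' = soft_threshold lam (D - A L')
      \<and> L' \<in> prox CARD('p) (t * \<mu>) (L' - t *\<^sub>R adjoint A (A L' + S' - D))"
    if lp: "seq_limit_point (\<lambda>k. (L k, S k)) (L', S')" for L' S'
  proof -
    obtain r where r: "strict_mono r" "\<And>j. 1 \<le> r j" and lim: "(\<lambda>j. (L (r j), S (r j))) \<longlonglongrightarrow> (L', S')"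
      using lp unfolding seq_limit_point_def by blast
    have Llim: "(\<lambda>j. L (r j)) \<longlonglongrightarrow> L'" and Slim: "(\<lambda>j. S (r j)) \<longlonglongrightarrow> S'"
      using tendsto_fst[OF lim] tendsto_snd[OF lim] by simp_all
    have Alim: "(\<lambda>j. A (Z j)) \<longlonglongrightarrow> A Z'" if "Z \<longlonglongrightarrow> Z'" for Z Z'
      using bounded_linear.tendsto[OF A that] .
    have adjlim: "(\<lambda>j. adjoint A (Z j)) \<longlonglongrightarrow> adjoint A Z'" if "Z \<longlonglongrightarrow> Z'" for Z Z'
      using bounded_linear.tendsto[OF _ that] adjoint_linear[OF linA]
      by (simp add: linear_conv_bounded_linear)
    \<comment> \<open>Subtracting a vanishing difference gives the successors the same limit, which
      the update formula then identifies.\<close>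
    have "(\<lambda>j. S (r j) - (S (r j) - S (Suc (r j)))) \<longlonglongrightarrow> S' - 0"
      using LIMSEQ_subseq_LIMSEQ[OF S_diff r(1)] by (intro tendsto_diff Slim) (simp add: o_def)
    then have SSuc: "(\<lambda>j. S (Suc (r j))) \<longlonglongrightarrow> S'"
      by simp
    moreover have "(\<lambda>j. S (Suc (r j))) \<longlonglongrightarrow> soft_threshold lam (D - A L')"
      unfolding S_Suc using lam_pos by (intro tendsto_soft_threshold tendsto_intros Alim Llim) simp
    ultimately have S': "S' = soft_threshold lam (D - A L')"
      by (rule LIMSEQ_unique)
    \<comment> \<open>The bounded factors pass the rank constraint on to the limit.\<close>
    have "bounded (range (\<lambda>j. (X (r j), Y (r j))))"
      using XYS_norm r(2) by (intro boundedI[of _ "K + sqrt (real CARD('p))"]) auto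
    moreover have "(\<lambda>j. X (r j) ** transpose (Y (r j))) \<longlonglongrightarrow> L'"
      using Llim L_factor[OF r(2)] by simp
    ultimately have rank: "rank L' \<le> CARD('p)"
      by (rule rank_limit_le)
    have "L' \<in> prox CARD('p) (t * \<mu>) (L' - t *\<^sub>R adjoint A (A L' + S' - D))"
      using \<kappa>_cases
    proof
      assume "\<kappa> < 1"
      have "(\<lambda>j. L (r j) + (L (Suc (r j)) - L (r j))) \<longlonglongrightarrow> L' + 0"
        using LIMSEQ_subseq_LIMSEQ[OF L_diff[OF \<open>\<kappa> < 1\<close>] r(1)]
        by (intro tendsto_add Llim) (simp add: o_def)
      then have LSuc: "(\<lambda>j. L (Suc (r j))) \<longlonglongrightarrow> L'"
        by simp
      show ?thesis
        by (rule prox_limit[OF L_Suc LSuc _ rank])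
          (intro tendsto_intros adjlim Alim Llim SSuc)
    next
      \<comment> \<open>Here \<open>L k\<close> is a proximal point of \<open>D - S k\<close>, so no control of \<open>L (k + 1) - L k\<close> is needed.\<close>
      assume id: "A = id \<and> t = 1"
      have "L k \<in> prox CARD('p) (t * \<mu>) (D - S k)" if "1 \<le> k" for k
        using L_step[OF that] id by (simp add: adjoint_id)
      then have "L' \<in> prox CARD('p) (t * \<mu>) (D - S')"
        using r(2) by (intro prox_limit[OF _ Llim _ rank, where B = "\<lambda>j. D - S (r j)"] tendsto_intros Slim) auto
      then show ?thesis
        using id by (simp add: adjoint_id)
    qed
    with S' show ?thesis by blast
  qed

  have part4: "seq_limit_point (\<lambda>k. (L k, S k)) (X' ** transpose Y', S')"
    if lp: "seq_limit_point (\<lambda>k. (X k, Y k, S k)) (X', Y', S')" for X' Y' S'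
  proof -
    obtain r where r: "strict_mono r" "\<And>j. 1 \<le> r j"
      and lim: "(\<lambda>j. (X (r j), Y (r j), S (r j))) \<longlonglongrightarrow> (X', Y', S')"
      using lp unfolding seq_limit_point_def by blast
    have "(\<lambda>j. X (r j)) \<longlonglongrightarrow> X'" "(\<lambda>j. Y (r j)) \<longlonglongrightarrow> Y'" "(\<lambda>j. S (r j)) \<longlonglongrightarrow> S'"
      using tendsto_fst[OF lim] tendsto_fst[OF tendsto_snd[OF lim]] tendsto_snd[OF tendsto_snd[OF lim]]
      by simp_all
    then have "(\<lambda>j. (L (r j), S (r j))) \<longlonglongrightarrow> (X' ** transpose Y', S')"
      unfolding L_factor[OF r(2)] by (intro tendsto_Pair tendsto_mult_transpose)
    with r show ?thesis
      unfolding seq_limit_point_def by blast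
  qed

  have part5: "stationary_point A D lam \<mu> X' Y' S'"
    if "seq_limit_point (\<lambda>k. (X k, Y k, S k)) (X', Y', S')" for X' Y' S'
    using part3[OF part4[OF that]]
    by (intro prox_fixed_point_stationary[OF linA t_pos \<mu>_nonneg lam_pos]) auto

  show ?thesis
    using part1 bounded_LS seq_limit_point_bounded[OF bounded_LS] part3 bounded_XYS part4 part5
    unfolding E_def by blast
qed

end
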